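(* Let $0<\alpha\le 2$, $0<\rho\le 1$, and let $\beta_i>1$, $\sigma_i>-1$ ($i\in\{1,2\}$) be constants. Suppose that $$\frac{1+\max\{\sigma_1+\beta_1(1+\sigma_2),\ \sigma_2+\beta_2(1+\sigma_1)\}}{\beta_1\beta_2-1}<\frac{d\rho}{\alpha}.$$ Then there exists an $\varepsilon>0$ such that if $$\varphi_i(x)=\varepsilon\,p(1,x),\qquad x\in\mathbb{R}^d,\ i\in\{1,2\},$$ then the solution $(u_1,u_2)$ of the integral system $$u_i(t,x)=\int_{\mathbb{R}^d}p(t^{\rho},y-x)\varphi_i(y)\,dy+\int_0^t\int_{\mathbb{R}^d}p(t^{\rho}-s^{\rho},y-x)\,s^{\sigma_i}u_j^{\beta_i}(s,y)\,dy\,ds,\qquad i\in\{1,2\},\ j=3-i,$$ satisfies, for $i\in\{1,2\}$, $$u_i(t,x)\le c\,\varepsilon\,(1+t)^{-k}(1+t^\rho)^{d/\alpha}\,p(1+t^\rho,x)\qquad\text{for all }(t,x)\in[0,\infty)\times\mathbb{R}^d,$$ where $c$ and $k$ are positive constants.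
   Context: The space dimension is $d\ge 1$. $p(t,x)$ ($t>0$, $x\in\mathbb{R}^d$) denotes the fundamental solution of $\frac{\partial}{\partial t}-\Delta_\alpha$, where $\Delta_\alpha=-(-\Delta)^{\alpha/2}$ is the $\alpha$-Laplacian (so $p$ is the symmetric $\alpha$-stable density). Solutions are positive (non-negative valued); the integral system is the mild formulation of $\partial_t u_i=\rho t^{\rho-1}\Delta_{\alpha}u_i+t^{\sigma_i}u_j^{\beta_i}$, $u_i(0)=\varphi_i$ ($i\in\{1,2\}$, $j=3-i$). *)

theory Defs
  imports "HOL-Analysis.Analysis"
begin

text \<open>
  The fundamental solution \<open>p(t,x)\<close> of \<open>\<partial>\<^sub>t - \<Delta>\<^sub>\<alpha>\<close>, where \<open>\<Delta>\<^sub>\<alpha> = - (- \<Delta>)\<^bsup>\<alpha>/2\<^esup>\<close> is the operator with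
  Fourier symbol \<open>- |\<xi>|\<^bsup>\<alpha>\<^esup>\<close>: for \<open>t > 0\<close> its Fourier transform in \<open>x\<close> is \<open>exp (- t |\<xi>|\<^bsup>\<alpha>\<^esup>)\<close>, that is,
  \<open>p(t,\<cdot>)\<close> is the density of the symmetric \<open>\<alpha>\<close>-stable law with this characteristic function. The
  integral is real, so \<open>Re\<close> only adjusts the type. For \<open>\<alpha> = 2\<close> it is the heat kernel
  \<open>(4 \<pi> t)\<^bsup>-d/2\<^esup> exp (- |x|\<^sup>2 / (4 t))\<close>. Only times \<open>t > 0\<close> are meaningful.
\<close>

definition stable_density :: "real \<Rightarrow> real \<Rightarrow> 'a::euclidean_space \<Rightarrow> real" where
  "stable_density \<alpha> t x =
     Re (LINT \<xi>|lborel. cis (x \<bullet> \<xi>) * of_real (exp (- t * norm \<xi> powr \<alpha>))) / (2 * pi) ^ DIM('a)"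

text \<open>
  Non-negative solutions on \<open>[0,\<infinity>) \<times> \<real>\<^sup>d\<close> of the integral system. The components are \<open>u 1\<close> and \<open>u 2\<close>,
  and \<open>3 - i\<close> is the index of the other component; values of \<open>u\<close> at other indices or at negative
  times are irrelevant. Since everything is non-negative, the integrals are taken in \<open>[0,\<infinity>]\<close>, and
  the equation forces them to be finite. At \<open>t = 0\<close> the kernel \<open>p(0,\<cdot>)\<close> is the Dirac measure, so that
  the equation there reads \<open>u\<^sub>i(0,x) = \<phi>\<^sub>i(x)\<close>. As usual for mild solutions, \<open>u\<close> is required
  to be bounded on \<open>[0,T] \<times> \<real>\<^sup>d\<close> for every finite \<open>T\<close>; without such a requirement one cannot speak of
  the solution, because unbounded solutions with the same initial value may exist.
\<close>

definition mild_solution ::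
  "real \<Rightarrow> real \<Rightarrow> (nat \<Rightarrow> real) \<Rightarrow> (nat \<Rightarrow> real) \<Rightarrow> (nat \<Rightarrow> 'a::euclidean_space \<Rightarrow> real)
    \<Rightarrow> (nat \<Rightarrow> real \<Rightarrow> 'a \<Rightarrow> real) \<Rightarrow> bool" where
  "mild_solution \<alpha> \<rho> \<beta> \<sigma> \<phi> u \<longleftrightarrow>
     (\<forall>i\<in>{1,2}.
        set_borel_measurable borel ({0..} \<times> UNIV) (\<lambda>(t, x). u i t x) \<and>
        (\<forall>t\<ge>0. \<forall>x. 0 \<le> u i t x) \<and>
        (\<forall>T. \<exists>M. \<forall>t\<in>{0..T}. \<forall>x. u i t x \<le> M) \<and>
        (\<forall>x. u i 0 x = \<phi> i x) \<and>
        (\<forall>t>0. \<forall>x. ennreal (u i t x) =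
           (\<integral>\<^sup>+ y. ennreal (stable_density \<alpha> (t powr \<rho>) (y - x) * \<phi> i y) \<partial>lborel) +
           (\<integral>\<^sup>+ s\<in>{0<..<t}.
              (\<integral>\<^sup>+ y. ennreal (stable_density \<alpha> (t powr \<rho> - s powr \<rho>) (y - x) *
                  s powr \<sigma> i * u (3 - i) s y powr \<beta> i) \<partial>lborel) \<partial>lborel)))"

end

theory Submission
  imports Defs "HOL-Probability.Probability"
begin

text \<open>
  The kernel \<open>p\<close> enters only through non-negativity, \<open>p(t,\<cdot>) * p(s,\<cdot>) = p(t+s,\<cdot>)\<close>, mass at most 1 and
  \<open>t\<^bsup>d/\<alpha>\<^esup> p(t,x) \<le> p(1,0)\<close>. Non-negativity is subordination: \<open>exp (- t r\<^bsup>\<alpha>/2\<^esup>)\<close> is a limit of positive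
  mixtures of the functions \<open>exp (- z r)\<close>, and with \<open>r = |\<xi>|\<^sup>2\<close> these have positive Fourier transforms.
  The convolution identity follows from Fourier inversion with a Gaussian regularization.

  Let \<open>k\<^sub>1, k\<^sub>2\<close> solve \<open>k\<^sub>j \<beta>\<^sub>i = k\<^sub>i + 1 + \<sigma>\<^sub>i\<close>; the hypothesis says exactly that both are below \<open>d\<rho>/\<alpha>\<close>. Then
  \<open>2 \<epsilon> (1+t)\<^bsup>-k\<^sub>i\<^esup> W(t) p(1+t\<^sup>\<rho>,x)\<close> with \<open>W(t) = (1+t\<^sup>\<rho>)\<^bsup>d/\<alpha>\<^esup>\<close> is a supersolution for small \<open>\<epsilon>\<close>: since \<open>W p\<close> is
  bounded, its power \<open>\<beta>\<^sub>i\<close> is at most a constant times \<open>W p\<close> itself, and the convolution identity reduces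
  the Duhamel term to an integral over time. Monotone iteration from \<open>0\<close> converges to a solution below
  the supersolution. Bounded solutions are unique by a Gronwall iteration, as \<open>s\<^bsup>\<sigma>\<^sub>i\<^esup>\<close> is integrable at \<open>0\<close>.
\<close>

section \<open>Gaussian integrals\<close>

text \<open>The Fourier integral defining p shows neither its sign nor its decay in x, so positivity
  has to be won first. As long as p is not known to be integrable, Fubini fails in the inversion
  formula, whence the Gaussian damping. Positivity makes the damped integrals increase to the mass,
  and once p is integrable it is its own majorant when the damping is removed under the
  characteristic function. The relation between \<open>k\<^sub>1\<close> and
  \<open>k\<^sub>2\<close> balances powers of time. Put D = d\<rho>/\<alpha>, so that W(s) is
  comparable to (1+s)^D. The Duhamel integrand has size
  \<open>s^\<sigma>\<^sub>i (1+s)^(D - k\<^sub>j \<beta>\<^sub>i)\<close>, and its integral up to t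
  is of order \<open>(1+t)^(D - k\<^sub>i)\<close>, exactly what a profile with exponent
  \<open>k\<^sub>i\<close> allows. This count requires \<open>k\<^sub>i < D\<close>; otherwise the
  contribution of small times alone exceeds that order. Of the factor 2 in the supersolution, one
  half pays for the linear part and the other for the Duhamel term, which is superlinear in
  \<epsilon>.\<close>

lemma
  fixes f :: "'a::euclidean_space \<Rightarrow> real \<Rightarrow> 'b::{real_normed_field,banach,second_countable_topology}"
  assumes f: "\<And>b. b \<in> Basis \<Longrightarrow> integrable lborel (f b)"
  shows integrable_lborel_Basis_prod: "integrable lborel (\<lambda>x. \<Prod>b\<in>Basis. f b (x \<bullet> b))" (is ?A)
    and integral_lborel_Basis_prod:
      "(LINT x|lborel. (\<Prod>b\<in>Basis. f b (x \<bullet> b))) = (\<Prod>b\<in>Basis. integral\<^sup>L lborel (f b))" (is ?B)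
proof -
  let ?T = "\<lambda>g. \<Sum>b\<in>Basis. g b *\<^sub>R b :: 'a"
  interpret product_sigma_finite "\<lambda>b::'a. lborel :: real measure"
    by standard
  have meas[measurable]: "(\<lambda>x. f b (x \<bullet> b)) \<in> borel_measurable borel" if "b \<in> Basis" for b
    using borel_measurable_integrable[OF f[OF that]] by measurable
  have "?T \<in> (\<Pi>\<^sub>M b\<in>Basis. lborel) \<rightarrow>\<^sub>M (borel :: 'a measure)"
    by measurable
  \<comment> \<open>By definition \<open>lborel\<close> is the image under \<open>?T\<close> of a
    product of copies of \<open>interval_measure\<close>, so measurability is needed for that form
    of the product.\<close>
  then have T[measurable]: "?T \<in> (\<Pi>\<^sub>M b\<in>Basis. interval_measure (\<lambda>x. x)) \<rightarrow>\<^sub>M (borel :: 'a measure)"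
    by (simp add: lborel_eq_real)
  have eq: "(\<Prod>b\<in>Basis. f b (?T g \<bullet> b)) = (\<Prod>b\<in>Basis. f b (g b))" for g
    by (intro prod.cong refl) (simp add: inner_sum_left inner_Basis if_distrib sum.delta cong: if_cong)
  show ?A
    unfolding lborel_def using product_integrable_prod[of Basis f, OF _ f]
    by (subst integrable_distr_eq) (simp_all add: eq lborel_eq_real)
  show ?B
    using product_integral_prod[of Basis f, OF _ f]
    by (subst lborel_def, subst integral_distr) (simp_all add: eq lborel_eq_real)
qed

lemma integral_gaussian_char_real:
  assumes "0 < s"
  shows "has_bochner_integral lborel (\<lambda>y::real. cis (x * y) * of_real (exp (- s * y\<^sup>2)))
           (of_real (sqrt (pi / s) * exp (- x\<^sup>2 / (4 * s))))"
proof -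
  \<comment> \<open>Evaluating the standard normal density at \<open>c * y\<close> turns the
    exponent \<open>- y\<^sup>2 / 2\<close> into \<open>- s * y\<^sup>2\<close>; the frequency
    \<open>x / c\<close> compensates the scaling.\<close>
  define c where "c = sqrt (2 * s)"
  have c: "c > 0" "c\<^sup>2 = 2 * s" using assms by (auto simp: c_def)
  let ?g = "\<lambda>y. std_normal_density y *\<^sub>R iexp (x / c * y)"
  have int: "integrable lborel ?g"
    by (rule Bochner_Integration.integrable_bound[of _ std_normal_density])
       (auto simp: norm_mult)
  have "integral\<^sup>L lborel ?g = char std_normal_distribution (x / c)"
    unfolding char_def by (subst integral_density) auto
  also have "\<dots> = of_real (exp (- x\<^sup>2 / (4 * s)))"
    using c by (simp add: char_std_normal_distribution power_divide)
  finally have A: "c *\<^sub>R (LINT y|lborel. ?g (0 + c * y)) = of_real (exp (- x\<^sup>2 / (4 * s)))"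
    using lborel_integral_real_affine[of c ?g 0] c by simp
  have B: "integrable lborel (\<lambda>y. ?g (0 + c * y))"
    by (rule lborel_integrable_real_affine[OF int]) (use c in auto)
  have 1: "has_bochner_integral lborel (\<lambda>y. ?g (0 + c * y)) (of_real (exp (- x\<^sup>2 / (4 * s))) /\<^sub>R c)"
    unfolding has_bochner_integral_iff A[symmetric] using B c by simp
  have 2: "?g (0 + c * y) = of_real (1 / sqrt (2 * pi)) * (cis (x * y) * of_real (exp (- s * y\<^sup>2)))" for y
    using c by (simp add: normal_density_def cis_conv_exp scaleR_conv_of_real power_mult_distrib field_simps)
  have 3: "sqrt (2*pi) / c = sqrt (pi / s)"
    unfolding c_def using assms by (simp add: real_sqrt_divide[symmetric])
  have "has_bochner_integral lborel (\<lambda>y. of_real (sqrt (2 * pi)) * ?g (0 + c * y))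
          (of_real (sqrt (2*pi)) * (of_real (exp (- x\<^sup>2 / (4 * s))) /\<^sub>R c))"
    using has_bochner_integral_mult_right[OF 1, of "of_real (sqrt (2 * pi))"] by simp
  then show ?thesis
    unfolding 2 3[symmetric] by (simp add: scaleR_conv_of_real field_simps)
qed

text \<open>Both \<open>cis (x \<bullet> \<xi>)\<close> and the Gaussian split into one factor per
  coordinate, which reduces the claim to the line.\<close>

lemma integral_gaussian_char:
  fixes x :: "'a::euclidean_space"
  assumes "0 < s"
  shows "has_bochner_integral lborel (\<lambda>\<xi>. cis (x \<bullet> \<xi>) * of_real (exp (- s * (norm \<xi>)\<^sup>2)))
           (of_real (sqrt (pi / s) ^ DIM('a) * exp (- (norm x)\<^sup>2 / (4 * s))))"
proof -
  let ?f = "\<lambda>b y. cis ((x \<bullet> b) * y) * of_real (exp (- s * y\<^sup>2))"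
  have nrm: "(norm y)\<^sup>2 = (\<Sum>b\<in>Basis. (y \<bullet> b)\<^sup>2)" for y :: 'a
    by (subst power2_norm_eq_inner, subst euclidean_inner) (simp add: power2_eq_square)
  have cis_sum: "cis (\<Sum>b\<in>A. g b) = (\<Prod>b\<in>A. cis (g b))" if "finite A" for A :: "'a set" and g
    using that by (induction A rule: finite_induct) (auto simp: cis_mult[symmetric])
  have 1: "(\<Prod>b\<in>Basis. ?f b (\<xi> \<bullet> b)) = cis (x \<bullet> \<xi>) * of_real (exp (- s * (norm \<xi>)\<^sup>2))" for \<xi>
    by (simp add: nrm euclidean_inner[of x \<xi>] prod.distrib cis_sum exp_sum[symmetric] sum_negf
         sum_distrib_left flip: of_real_prod)
  have "(\<Prod>b\<in>Basis. integral\<^sup>L lborel (?f b)) =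
        (\<Prod>b\<in>Basis. of_real (sqrt (pi / s) * exp (- (x \<bullet> b)\<^sup>2 / (4 * s))))"
    using integral_gaussian_char_real[OF assms] by (simp add: has_bochner_integral_iff)
  also have "\<dots> = of_real (sqrt (pi / s) ^ DIM('a) * exp (- (norm x)\<^sup>2 / (4 * s)))"
    by (simp add: nrm prod.distrib exp_sum[symmetric] sum_negf sum_divide_distrib flip: of_real_prod)
  finally have 2: "(\<Prod>b\<in>Basis. integral\<^sup>L lborel (?f b)) = \<dots>" .
  have 3: "integrable lborel (?f b)" for b
    using integral_gaussian_char_real[OF assms] by (simp add: has_bochner_integral_iff)
  show ?thesis
    using integrable_lborel_Basis_prod[of ?f, OF 3] integral_lborel_Basis_prod[of ?f, OF 3]
    unfolding 1 2 has_bochner_integral_iff by simp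
qed

lemma integrable_gaussian:
  assumes "0 < s"
  shows "integrable lborel (\<lambda>\<xi>::'a::euclidean_space. exp (- s * (norm \<xi>)\<^sup>2))"
proof -
  have "integrable lborel (\<lambda>\<xi>::'a. norm (cis (0 \<bullet> \<xi>) * complex_of_real (exp (- s * (norm \<xi>)\<^sup>2))))"
    using integral_gaussian_char[OF assms, of "0::'a"] by (intro integrable_norm) (simp add: has_bochner_integral_iff)
  then show ?thesis by (simp add: norm_mult)
qed

lemma integral_gaussian:
  assumes "0 < s"
  shows "(LINT \<xi>|lborel. exp (- s * (norm (\<xi>::'a::euclidean_space))\<^sup>2)) = sqrt (pi / s) ^ DIM('a)"
proof -
  have "complex_of_real (LINT \<xi>|lborel. exp (- s * (norm (\<xi>::'a))\<^sup>2)) = of_real (sqrt (pi / s) ^ DIM('a))"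
    using integral_gaussian_char[OF assms, of "0::'a"]
    by (simp add: has_bochner_integral_iff flip: integral_complex_of_real)
  then show ?thesis by (simp only: of_real_eq_iff)
qed

text \<open>The majorant is a product of one-dimensional Cauchy weights, integrable factor by
  factor. Each coordinate satisfies 1 + x_b^2 \<le> 1 + |x|^2, so the comparison costs d powers of 1
  + |x|^2, which the stretched exponential absorbs.\<close>

lemma integrable_exp_powr:
  assumes "0 < t" "0 < \<alpha>"
  shows "integrable lborel (\<lambda>\<xi>::'a::euclidean_space. exp (- t * norm \<xi> powr \<alpha>))"
proof -
  define d where "d = DIM('a)"
  have 1: "integrable lborel (\<lambda>x::real. inverse (1 + x\<^sup>2))"
    using integrable_inverse_1_plus_square by (simp add: set_integrable_def)
  have I: "integrable lborel (\<lambda>x::'a. \<Prod>b\<in>Basis. inverse (1 + (x \<bullet> b)\<^sup>2))"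
    by (rule integrable_lborel_Basis_prod[OF 1])
  have "((\<lambda>r. (1 + r\<^sup>2) powr d * exp (- t * r powr \<alpha>)) \<longlongrightarrow> 0) at_top"
    using assms by real_asymp
  then have "\<forall>\<^sub>F r in at_top. (1 + r\<^sup>2) powr d * exp (- t * r powr \<alpha>) < 1"
    by (rule order_tendstoD) simp
  then obtain R where R: "\<And>r. r \<ge> R \<Longrightarrow> (1 + r\<^sup>2) powr d * exp (- t * r powr \<alpha>) < 1"
    by (auto simp: eventually_at_top_linorder)
  \<comment> \<open>Beyond \<open>R\<close> the product is below 1, and before \<open>R\<close> it
    is at most \<open>(1 + R\<^sup>2) ^ d\<close>; the sum covers both cases.\<close>
  define C where "C = (1 + R\<^sup>2) ^ d + 1"
  have C: "(1 + r\<^sup>2) ^ d * exp (- t * r powr \<alpha>) \<le> C" if "r \<ge> 0" for r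
  proof (cases "r \<ge> R")
    case True
    have "1 + r\<^sup>2 > 0" by (simp add: add_pos_nonneg)
    then have "(1 + r\<^sup>2) ^ d * exp (- t * r powr \<alpha>) < 1"
      using R[OF True] by (simp add: powr_realpow)
    also have "1 \<le> C" by (simp add: C_def)
    finally show ?thesis by simp
  next
    case False
    then have "(1 + r\<^sup>2) ^ d * exp (- t * r powr \<alpha>) \<le> (1 + R\<^sup>2) ^ d * 1"
      using that assms by (intro mult_mono power_mono add_mono) auto
    then show ?thesis by (simp add: C_def)
  qed
  show ?thesis
  proof (rule Bochner_Integration.integrable_bound)
    show "integrable lborel (\<lambda>x::'a. C * (\<Prod>b\<in>Basis. inverse (1 + (x \<bullet> b)\<^sup>2)))"
      using I by simp
    show "AE x::'a in lborel. norm (exp (- t * norm x powr \<alpha>)) \<le> norm (C * (\<Prod>b\<in>Basis. inverse (1 + (x \<bullet> b)\<^sup>2)))"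
    proof (rule AE_I2)
      fix x :: 'a
      have C0: "C > 0" by (simp add: C_def add_nonneg_pos)
      have "(\<Prod>b\<in>Basis. (1 + (x \<bullet> b)\<^sup>2)) \<le> (\<Prod>b\<in>(Basis::'a set). (1 + (norm x)\<^sup>2))"
        by (intro prod_mono) (auto simp: Basis_le_norm abs_le_square_iff[symmetric])
      also have "\<dots> = (1 + (norm x)\<^sup>2) ^ d" by (simp add: d_def)
      finally have *: "(\<Prod>b\<in>Basis. (1 + (x \<bullet> b)\<^sup>2)) \<le> (1 + (norm x)\<^sup>2) ^ d" .
      have pos: "(\<Prod>b\<in>Basis. (1 + (x \<bullet> b)\<^sup>2)) > 0"
        by (intro prod_pos) (auto simp: add_pos_nonneg)
      have "exp (- t * norm x powr \<alpha>) * (\<Prod>b\<in>Basis. (1 + (x \<bullet> b)\<^sup>2)) \<le> C"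
        using order_trans[OF mult_left_mono[OF *, of "exp (- t * norm x powr \<alpha>)"]] C[of "norm x"]
        by (simp add: mult.commute)
      then have "exp (- t * norm x powr \<alpha>) \<le> C * (\<Prod>b\<in>Basis. inverse (1 + (x \<bullet> b)\<^sup>2))"
        using pos by (simp add: inverse_eq_divide prod_dividef field_simps)
      then show "norm (exp (- t * norm x powr \<alpha>)) \<le> norm (C * (\<Prod>b\<in>Basis. inverse (1 + (x \<bullet> b)\<^sup>2)))"
        by simp
    qed
  qed simp
qed

text \<open>A majorant in product form is what each Fubini exchange below is justified by.\<close>

lemma integrable_lborel_pair_bound:
  fixes F :: "'a::euclidean_space \<Rightarrow> 'b::euclidean_space \<Rightarrow> 'c::{banach,second_countable_topology}"
    and u :: "'a \<Rightarrow> real" and v :: "'b \<Rightarrow> real"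
  assumes F: "case_prod F \<in> borel_measurable (lborel \<Otimes>\<^sub>M lborel)"
    and u: "integrable lborel u" and v: "integrable lborel v"
    and le: "\<And>x y. norm (F x y) \<le> u x * v y"
  shows "integrable (lborel \<Otimes>\<^sub>M lborel) (case_prod F)"
proof (rule Bochner_Integration.integrable_bound)
  note [measurable] = borel_measurable_integrable[OF u] borel_measurable_integrable[OF v]
  show "integrable (lborel \<Otimes>\<^sub>M lborel) (\<lambda>(x, y). u x * v y)"
    using u v by (intro lborel_pair.Fubini_integrable) (auto simp: abs_mult)
  show "AE z in lborel \<Otimes>\<^sub>M lborel. norm (case_prod F z) \<le> norm (case z of (x, y) \<Rightarrow> u x * v y)"
    using order_trans[OF le abs_ge_self] by (intro AE_I2) auto
qed (rule F)

section \<open>Positivity of the stable density\<close>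

text \<open>
  The Gaussian factor with arbitrary \<open>s > 0\<close> makes the class closed under multiplication by Laplace
  transforms, because \<open>exp (- z |\<xi>|\<^sup>2)\<close> is absorbed by shifting \<open>s\<close>.
\<close>

definition gaussian_positive :: "'a::euclidean_space itself \<Rightarrow> (real \<Rightarrow> real) \<Rightarrow> bool" where
  "gaussian_positive _ f \<longleftrightarrow> f \<in> borel_measurable borel \<and> (\<exists>B. \<forall>r\<ge>0. \<bar>f r\<bar> \<le> B) \<and>
     (\<forall>s>0. \<forall>x::'a. 0 \<le> (LINT \<xi>|lborel. cos (x \<bullet> \<xi>) * f ((norm \<xi>)\<^sup>2) * exp (- s * (norm \<xi>)\<^sup>2)))"

lemma gaussian_positive_integrable:
  assumes "f \<in> borel_measurable borel" "\<And>r. r \<ge> 0 \<Longrightarrow> \<bar>f r\<bar> \<le> B" "0 < s"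
  shows "integrable lborel (\<lambda>\<xi>::'a::euclidean_space. cos (x \<bullet> \<xi>) * f ((norm \<xi>)\<^sup>2) * exp (- s * (norm \<xi>)\<^sup>2))"
proof (rule Bochner_Integration.integrable_bound)
  note [measurable] = assms(1)
  show "integrable lborel (\<lambda>\<xi>::'a. B * exp (- s * (norm \<xi>)\<^sup>2))"
    using integrable_gaussian[OF assms(3), where 'a='a] by simp
  show "(\<lambda>\<xi>::'a. cos (x \<bullet> \<xi>) * f ((norm \<xi>)\<^sup>2) * exp (- s * (norm \<xi>)\<^sup>2)) \<in> borel_measurable lborel"
    by measurable
  have "\<bar>cos (x \<bullet> \<xi>)\<bar> * \<bar>f ((norm \<xi>)\<^sup>2)\<bar> \<le> 1 * \<bar>B\<bar>" for \<xi> :: 'a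
    using assms(2)[of "(norm \<xi>)\<^sup>2"] by (intro mult_mono) auto
  then show "AE \<xi>::'a in lborel. norm (cos (x \<bullet> \<xi>) * f ((norm \<xi>)\<^sup>2) * exp (- s * (norm \<xi>)\<^sup>2))
               \<le> norm (B * exp (- s * (norm \<xi>)\<^sup>2))"
    by (simp add: abs_mult)
qed

text \<open>A bound uniform in \<open>n\<close>, multiplied by the Gaussian, is an integrable
  majorant, so positivity survives pointwise limits.\<close>

lemma gaussian_positive_limit:
  assumes F: "\<And>n. gaussian_positive TYPE('a::euclidean_space) (F n)"
    and B: "\<And>n r. r \<ge> 0 \<Longrightarrow> \<bar>F n r\<bar> \<le> B"
    and f[measurable]: "f \<in> borel_measurable borel"
    and lim: "\<And>r. r \<ge> 0 \<Longrightarrow> (\<lambda>n. F n r) \<longlonglongrightarrow> f r"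
  shows "gaussian_positive TYPE('a) f"
  unfolding gaussian_positive_def
proof (intro conjI allI impI exI)
  have [measurable]: "F n \<in> borel_measurable borel" for n
    using F[of n] by (simp add: gaussian_positive_def)
  fix s :: real and x :: 'a assume s: "0 < s"
  show "0 \<le> (LINT \<xi>|lborel. cos (x \<bullet> \<xi>) * f ((norm \<xi>)\<^sup>2) * exp (- s * (norm \<xi>)\<^sup>2))"
  proof (rule LIMSEQ_le_const)
    show "(\<lambda>n. LINT \<xi>|lborel. cos (x \<bullet> \<xi>) * F n ((norm \<xi>)\<^sup>2) * exp (- s * (norm \<xi>)\<^sup>2)) \<longlonglongrightarrow>
        (LINT \<xi>|lborel. cos (x \<bullet> \<xi>) * f ((norm \<xi>)\<^sup>2) * exp (- s * (norm \<xi>)\<^sup>2))"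
    proof (rule integral_dominated_convergence)
      show "integrable lborel (\<lambda>\<xi>::'a. B * exp (- s * (norm \<xi>)\<^sup>2))"
        using integrable_gaussian[OF s, where 'a='a] by simp
      show "AE \<xi> in lborel. (\<lambda>n. cos (x \<bullet> \<xi>) * F n ((norm \<xi>)\<^sup>2) * exp (- s * (norm \<xi>)\<^sup>2))
          \<longlonglongrightarrow> cos (x \<bullet> \<xi>) * f ((norm \<xi>)\<^sup>2) * exp (- s * (norm \<xi>)\<^sup>2)"
        by (intro AE_I2 tendsto_intros lim) simp
      have "\<bar>cos (x \<bullet> \<xi>)\<bar> * \<bar>F n ((norm \<xi>)\<^sup>2)\<bar> \<le> 1 * B" for \<xi> :: 'a and n
        by (intro mult_mono B) auto
      then show "AE \<xi> in lborel. norm (cos (x \<bullet> \<xi>) * F n ((norm \<xi>)\<^sup>2) * exp (- s * (norm \<xi>)\<^sup>2))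
               \<le> B * exp (- s * (norm \<xi>)\<^sup>2)" for n
        by (simp add: abs_mult)
    qed measurable
    show "\<exists>N. \<forall>n\<ge>N. 0 \<le> (LINT \<xi>|lborel. cos (x \<bullet> \<xi>) * F n ((norm \<xi>)\<^sup>2) * exp (- s * (norm \<xi>)\<^sup>2))"
      using F s by (auto simp: gaussian_positive_def)
  qed
next
  fix r :: real assume "0 \<le> r"
  then show "\<bar>f r\<bar> \<le> B"
    by (intro LIMSEQ_le_const2[OF tendsto_rabs[OF lim]]) (auto intro: B)
qed simp

lemma gaussian_positive_add:
  assumes "gaussian_positive TYPE('a::euclidean_space) f" "gaussian_positive TYPE('a) g"
  shows "gaussian_positive TYPE('a) (\<lambda>r. f r + g r)"
proof -
  obtain B C where B: "\<And>r. r \<ge> 0 \<Longrightarrow> \<bar>f r\<bar> \<le> B" and C: "\<And>r. r \<ge> 0 \<Longrightarrow> \<bar>g r\<bar> \<le> C"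
    using assms by (auto simp: gaussian_positive_def)
  have [measurable]: "f \<in> borel_measurable borel" "g \<in> borel_measurable borel"
    using assms by (auto simp: gaussian_positive_def)
  have "0 \<le> (LINT \<xi>|lborel. cos (x \<bullet> \<xi>) * (f ((norm \<xi>)\<^sup>2) + g ((norm \<xi>)\<^sup>2)) * exp (- s * (norm \<xi>)\<^sup>2))"
    if "s > 0" for s :: real and x :: 'a
  proof -
    have "(LINT \<xi>|lborel. cos (x \<bullet> \<xi>) * (f ((norm \<xi>)\<^sup>2) + g ((norm \<xi>)\<^sup>2)) * exp (- s * (norm \<xi>)\<^sup>2))
      = (LINT \<xi>|lborel. cos (x \<bullet> \<xi>) * f ((norm \<xi>)\<^sup>2) * exp (- s * (norm \<xi>)\<^sup>2))
      + (LINT \<xi>|lborel. cos (x \<bullet> \<xi>) * g ((norm \<xi>)\<^sup>2) * exp (- s * (norm \<xi>)\<^sup>2))"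
      unfolding distrib_left distrib_right
      by (intro Bochner_Integration.integral_add gaussian_positive_integrable[OF _ B]
            gaussian_positive_integrable[OF _ C]) (use that in auto)
    then show ?thesis using assms that by (simp add: gaussian_positive_def)
  qed
  moreover have "\<bar>f r + g r\<bar> \<le> B + C" if "r \<ge> 0" for r
    using B[OF that] C[OF that] by linarith
  ultimately show ?thesis unfolding gaussian_positive_def by (intro conjI exI[of _ "B + C"]) auto
qed

lemma gaussian_positive_cmult:
  assumes "gaussian_positive TYPE('a::euclidean_space) f" "0 \<le> c"
  shows "gaussian_positive TYPE('a) (\<lambda>r. c * f r)"
proof -
  obtain B where B: "\<And>r. r \<ge> 0 \<Longrightarrow> \<bar>f r\<bar> \<le> B"
    using assms by (auto simp: gaussian_positive_def)
  have eq: "(LINT \<xi>|lborel. cos (x \<bullet> \<xi>) * (c * f ((norm \<xi>)\<^sup>2)) * exp (- s * (norm \<xi>)\<^sup>2))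
      = c * (LINT \<xi>|lborel. cos (x \<bullet> \<xi>) * f ((norm \<xi>)\<^sup>2) * exp (- s * (norm \<xi>)\<^sup>2))" for s :: real and x :: 'a
    unfolding integral_mult_right_zero[symmetric] by (simp add: ac_simps)
  show ?thesis unfolding gaussian_positive_def eq
    using assms B by (auto simp: gaussian_positive_def abs_mult intro!: exI[of _ "c * B"] mult_left_mono)
qed

lemma gaussian_positive_exp:
  assumes "0 \<le> z"
  shows "gaussian_positive TYPE('a::euclidean_space) (\<lambda>r. exp (- z * r))"
proof -
  have "0 \<le> (LINT \<xi>|lborel. cos (x \<bullet> \<xi>) * exp (- z * (norm \<xi>)\<^sup>2) * exp (- s * (norm \<xi>)\<^sup>2))"
    if s: "s > 0" for s :: real and x :: 'a
  proof -
    have zs: "0 < z + s" using assms s by simp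
    note G = integral_gaussian_char[OF zs, of x, unfolded has_bochner_integral_iff]
    have "(LINT \<xi>|lborel. cos (x \<bullet> \<xi>) * exp (- z * (norm \<xi>)\<^sup>2) * exp (- s * (norm \<xi>)\<^sup>2))
      = (LINT \<xi>|lborel. Re (cis (x \<bullet> \<xi>) * of_real (exp (- (z + s) * (norm \<xi>)\<^sup>2))))"
      by (intro Bochner_Integration.integral_cong refl) (simp add: exp_add[symmetric] algebra_simps)
    also have "\<dots> = Re (of_real (sqrt (pi / (z+s)) ^ DIM('a) * exp (- (norm x)\<^sup>2 / (4 * (z+s)))))"
      using G by (subst integral_Re) auto
    finally show ?thesis using zs by simp
  qed
  then show ?thesis unfolding gaussian_positive_def
    using assms by (auto intro!: exI[of _ 1])
qed

text \<open>By Fubini the new integral is a mixture, with weights \<open>h z\<close>, of the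
  integrals for \<open>f\<close> with Gaussian parameter \<open>s + z\<close> in place of
  \<open>s\<close>. Since \<open>h\<close> vanishes for negative \<open>z\<close>, only parameters
  \<open>s + z > 0\<close> contribute.\<close>

lemma gaussian_positive_laplace:
  assumes f: "gaussian_positive TYPE('a::euclidean_space) f"
    and h: "integrable lborel h" "\<And>z. 0 \<le> h z" "\<And>z. z < 0 \<Longrightarrow> h z = 0"
  shows "gaussian_positive TYPE('a) (\<lambda>r. f r * (LINT z|lborel. exp (- z * r) * h z))"
proof -
  let ?g = "\<lambda>r. LINT z|lborel. exp (- z * r) * h z"
  obtain B where B: "\<And>r. r \<ge> 0 \<Longrightarrow> \<bar>f r\<bar> \<le> B" and [measurable]: "f \<in> borel_measurable borel"
    using f by (auto simp: gaussian_positive_def)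
  have [measurable]: "h \<in> borel_measurable borel"
    using borel_measurable_integrable[OF h(1)] by simp
  have B0: "B \<ge> 0" using B[of 0] by auto
  have hexp: "exp (- z * r) * h z \<le> h z" if "r \<ge> 0" for r z
    using h(2,3)[of z] that by (cases "z < 0") (auto simp: mult_left_le_one_le)
  have inth: "integrable lborel (\<lambda>z. exp (- z * r) * h z)" if "r \<ge> 0" for r
    by (rule Bochner_Integration.integrable_bound[OF h(1)]) (use hexp[OF that] h(2) in auto)
  have gb: "\<bar>?g r\<bar> \<le> integral\<^sup>L lborel h" if "r \<ge> 0" for r
  proof -
    have "?g r \<ge> 0" by (intro Bochner_Integration.integral_nonneg) (simp add: h)
    moreover have "?g r \<le> integral\<^sup>L lborel h"
      using hexp[OF that] by (intro integral_mono inth h that) auto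
    ultimately show ?thesis by simp
  qed
  have "0 \<le> (LINT \<xi>|lborel. cos (x \<bullet> \<xi>) * (f ((norm \<xi>)\<^sup>2) * ?g ((norm \<xi>)\<^sup>2)) * exp (- s * (norm \<xi>)\<^sup>2))"
    if s: "s > 0" for s :: real and x :: 'a
  proof -
    define F where "F = (\<lambda>(\<xi>::'a) z. cos (x \<bullet> \<xi>) * f ((norm \<xi>)\<^sup>2) * exp (- (s + z) * (norm \<xi>)\<^sup>2) * h z)"
    have ex: "exp (- (s + z) * q) = exp (- s * q) * exp (- z * q)" for z q
      by (simp add: mult_exp_exp algebra_simps)
    have bd: "norm (F \<xi> z) \<le> (B * exp (- s * (norm \<xi>)\<^sup>2)) * h z" for \<xi> z
    proof -
      have "\<bar>cos (x \<bullet> \<xi>)\<bar> * \<bar>f ((norm \<xi>)\<^sup>2)\<bar> \<le> 1 * B"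
        by (intro mult_mono B) auto
      then have "(\<bar>cos (x \<bullet> \<xi>)\<bar> * \<bar>f ((norm \<xi>)\<^sup>2)\<bar>) * (exp (- s * (norm \<xi>)\<^sup>2) * (exp (- z * (norm \<xi>)\<^sup>2) * h z))
         \<le> (1 * B) * (exp (- s * (norm \<xi>)\<^sup>2) * h z)"
        by (rule mult_mono) (use hexp[of "(norm \<xi>)\<^sup>2" z] h(2)[of z] B0 in \<open>simp_all add: mult_left_mono\<close>)
      then show ?thesis using h(2)[of z]
        unfolding F_def ex by (simp add: abs_mult ac_simps)
    qed
    have int: "integrable (lborel \<Otimes>\<^sub>M lborel) (case_prod F)"
    proof (rule integrable_lborel_pair_bound[OF _ _ h(1) bd])
      show "integrable lborel (\<lambda>\<xi>::'a. B * exp (- s * (norm \<xi>)\<^sup>2))"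
        using integrable_gaussian[OF s, where 'a='a] by simp
      show "case_prod F \<in> borel_measurable (lborel \<Otimes>\<^sub>M lborel)"
        unfolding F_def by measurable
    qed
    have "(LINT \<xi>|lborel. cos (x \<bullet> \<xi>) * (f ((norm \<xi>)\<^sup>2) * ?g ((norm \<xi>)\<^sup>2)) * exp (- s * (norm \<xi>)\<^sup>2))
      = (LINT \<xi>|lborel. LINT z|lborel. F \<xi> z)"
    proof (rule Bochner_Integration.integral_cong[OF refl])
      fix \<xi> :: 'a
      have Fz: "F \<xi> z = (cos (x \<bullet> \<xi>) * f ((norm \<xi>)\<^sup>2) * exp (- s * (norm \<xi>)\<^sup>2)) * (exp (- z * (norm \<xi>)\<^sup>2) * h z)" for z
        unfolding F_def ex by (simp add: ac_simps)
      then show "cos (x \<bullet> \<xi>) * (f ((norm \<xi>)\<^sup>2) * ?g ((norm \<xi>)\<^sup>2)) * exp (- s * (norm \<xi>)\<^sup>2) = (LINT z|lborel. F \<xi> z)"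
        unfolding Fz integral_mult_right_zero by (simp add: ac_simps)
    qed
    also have "\<dots> = (LINT z|lborel. LINT \<xi>|lborel. F \<xi> z)"
      by (rule lborel_pair.Fubini_integral[OF int, symmetric])
    also have "\<dots> \<ge> 0"
    proof (rule Bochner_Integration.integral_nonneg)
      fix z
      have "(LINT \<xi>|lborel. F \<xi> z) = (LINT \<xi>|lborel. cos (x \<bullet> \<xi>) * f ((norm \<xi>)\<^sup>2) * exp (- (s + z) * (norm \<xi>)\<^sup>2)) * h z"
        unfolding F_def by simp
      moreover have "0 \<le> \<dots>"
      proof (cases "z < 0")
        case False
        with s have "0 < s + z" by simp
        with f have "0 \<le> (LINT \<xi>|lborel. cos (x \<bullet> \<xi>) * f ((norm \<xi>)\<^sup>2) * exp (- (s + z) * (norm \<xi>)\<^sup>2))"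
          unfolding gaussian_positive_def by blast
        then show ?thesis by (rule mult_nonneg_nonneg[OF _ h(2)])
      qed (simp add: h(3))
      ultimately show "0 \<le> (LINT \<xi>|lborel. F \<xi> z)" by simp
    qed
    finally show ?thesis .
  qed
  moreover have "\<bar>f r * ?g r\<bar> \<le> B * integral\<^sup>L lborel h" if "r \<ge> 0" for r
    unfolding abs_mult by (intro mult_mono B gb that B0) auto
  moreover have "(\<lambda>r. f r * ?g r) \<in> borel_measurable borel" by measurable
  ultimately show ?thesis
    unfolding gaussian_positive_def by (intro conjI exI[of _ "B * integral\<^sup>L lborel h"]) auto
qed

text \<open>Powers of a Laplace transform are covered by iterating the previous closure property.
  The partial sums of the exponential series have non-negative coefficients and are bounded by
  \<open>exp (c * B)\<close>, uniformly in their length.\<close>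

lemma gaussian_positive_exp_laplace:
  assumes h: "integrable lborel h" "\<And>z. 0 \<le> h z" "\<And>z. z < 0 \<Longrightarrow> h z = 0"
    and c: "0 \<le> c"
  shows "gaussian_positive TYPE('a::euclidean_space) (\<lambda>r. exp (c * (LINT z|lborel. exp (- z * r) * h z)))"
proof -
  let ?g = "\<lambda>r. LINT z|lborel. exp (- z * r) * h z"
  have [measurable]: "h \<in> borel_measurable borel"
    using borel_measurable_integrable[OF h(1)] by simp
  have one: "gaussian_positive TYPE('a) (\<lambda>r. 1)"
    using gaussian_positive_exp[of 0, where 'a='a] by simp
  have pw: "gaussian_positive TYPE('a) (\<lambda>r. ?g r ^ k)" for k
  proof (induction k)
    case (Suc k)
    from gaussian_positive_laplace[OF this h] show ?case by (simp add: mult.commute)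
  qed (use one in simp)
  have sums: "gaussian_positive TYPE('a) (\<lambda>r. \<Sum>k<n. (c * ?g r) ^ k /\<^sub>R fact k)" for n
  proof (induction n)
    case 0
    show ?case using gaussian_positive_cmult[OF one, of 0] by simp
  next
    case (Suc n)
    have "(c * ?g r) ^ n /\<^sub>R fact n = (c ^ n / fact n) * ?g r ^ n" for r
      by (simp add: power_mult_distrib field_simps)
    then show ?case
      using gaussian_positive_add[OF Suc gaussian_positive_cmult[OF pw, of "c ^ n / fact n" n]] c by simp
  qed
  obtain B where B: "\<And>r. r \<ge> 0 \<Longrightarrow> \<bar>?g r\<bar> \<le> B"
    using pw[of 1] by (auto simp: gaussian_positive_def)
  show ?thesis
  proof (rule gaussian_positive_limit[OF sums])
    fix n and r :: real assume r: "0 \<le> r"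
    have "\<bar>\<Sum>k<n. (c * ?g r) ^ k /\<^sub>R fact k\<bar> \<le> (\<Sum>k<n. \<bar>(c * ?g r) ^ k /\<^sub>R fact k\<bar>)"
      by (rule sum_abs)
    also have "\<dots> \<le> (\<Sum>k<n. (c * B) ^ k /\<^sub>R fact k)"
      using c B[OF r] by (intro sum_mono) (auto simp: abs_mult power_abs intro!: divide_right_mono power_mono mult_left_mono mult_nonneg_nonneg)
    also have "\<dots> \<le> exp (c * B)"
      unfolding exp_def using B[OF r] c by (intro sum_le_suminf summable_exp_generic) (auto intro!: mult_nonneg_nonneg)
    finally show "\<bar>\<Sum>k<n. (c * ?g r) ^ k /\<^sub>R fact k\<bar> \<le> exp (c * B)" .
  next
    show "(\<lambda>n. \<Sum>k<n. (c * ?g r) ^ k /\<^sub>R fact k) \<longlonglongrightarrow> exp (c * ?g r)" for r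
      unfolding exp_def by (intro summable_LIMSEQ summable_exp_generic)
  qed measurable
qed

section \<open>Subordination of the stretched exponential\<close>

lemma integrable_powr_from_0:
  assumes "a > (-1::real)" "c \<ge> 0"
  shows "integrable lborel (\<lambda>x. indicator {0..c} x * x powr a)"
proof (rule integrableI_nonneg)
  show "(\<integral>\<^sup>+x. ennreal (indicator {0..c} x * x powr a) \<partial>lborel) < \<infinity>"
    using nn_integral_has_integral_lebesgue[OF _ has_integral_powr_from_0[OF assms]] by simp
qed auto

lemma integrable_powr_to_inf:
  assumes "e < (-1::real)" "a > 0"
  shows "integrable lborel (\<lambda>x. indicator {a..} x * x powr e)"
proof (rule integrableI_nonneg)
  show "(\<integral>\<^sup>+x. ennreal (indicator {a..} x * x powr e) \<partial>lborel) < \<infinity>"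
    using nn_integral_has_integral_lebesgue[OF _ has_integral_powr_to_inf[OF assms]] by simp
qed auto

text \<open>\<open>z powr (- 1 - a)\<close> is the Levy density of the \<open>a\<close>-stable
  subordinator, up to a constant. The integral converges at 0 because
  \<open>1 - exp (- z) \<le> z\<close> and \<open>a < 1\<close>, and at infinity because
  \<open>a > 0\<close>. Substituting \<open>r * z\<close> for \<open>z\<close> shows homogeneity of
  degree \<open>a\<close> in \<open>r\<close>, so \<open>K\<close> is the value at
  \<open>r = 1\<close>.\<close>

lemma subordination_integral:
  fixes a :: real
  assumes a: "0 < a" "a < 1"
  defines "k \<equiv> \<lambda>r z. indicator {0<..} z * ((1 - exp (- z * r)) * z powr (- 1 - a))"
  shows "\<exists>K>0. \<forall>r\<ge>0. integrable lborel (k r) \<and> integral\<^sup>L lborel (k r) = K * r powr a"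
proof -
  have [measurable]: "k r \<in> borel_measurable borel" for r
    unfolding k_def by measurable
  have k0: "0 \<le> k 1 z" for z
    by (auto simp: k_def indicator_def)
  have i1: "integrable lborel (k 1)"
  proof (rule Bochner_Integration.integrable_bound)
    show "integrable lborel (\<lambda>z. indicator {0..1} z * z powr (- a) + indicator {1..} z * z powr (-1 - a))"
      using a by (intro Bochner_Integration.integrable_add integrable_powr_from_0 integrable_powr_to_inf) auto
    have "k 1 z \<le> indicator {0..1} z * z powr (- a) + indicator {1..} z * z powr (-1 - a)" for z
    proof -
      consider "z \<le> 0" | "0 < z" "z < 1" | "1 \<le> z" by linarith
      then show ?thesis
      proof cases
        case 2
        have "1 - exp (- z) \<le> z" using exp_ge_add_one_self[of "-z"] by linarith
        then have "(1 - exp (- z)) * z powr (- 1 - a) \<le> z * z powr (-1 - a)"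
          by (intro mult_right_mono) auto
        also have "\<dots> = z powr (- a)" using 2 powr_mult_base[of z "-1-a"] by simp
        finally show ?thesis using 2 by (simp add: k_def)
      next
        case 3
        then have "(1 - exp (- z)) * z powr (- 1 - a) \<le> 1 * z powr (-1 - a)"
          by (intro mult_right_mono) auto
        then show ?thesis using 3 by (simp add: k_def add_increasing)
      qed (auto simp: k_def indicator_def)
    qed
    then show "AE z in lborel. norm (k 1 z) \<le> norm (indicator {0..1} z * z powr (- a) + indicator {1..} z * z powr (-1 - a))"
      using k0 by (intro AE_I2) (metis abs_ge_self abs_of_nonneg order_trans real_norm_def)
  qed measurable
  \<comment> \<open>A lower bound of \<open>k 1\<close> on [1,2]: the first factor is smallest at
    \<open>z = 1\<close>, the second at \<open>z = 2\<close>. It makes \<open>K\<close>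
    positive.\<close>
  define m where "m = (1 - exp (-1)) * 2 powr (-1 - a)"
  have m: "m > 0" by (simp add: m_def)
  have mk: "m * indicator {1..2} z \<le> k 1 z" for z
  proof (cases "z \<in> {1..2}")
    case True
    then have "m \<le> (1 - exp (- z)) * z powr (- 1 - a)"
      unfolding m_def using a by (intro mult_mono powr_mono2') auto
    then show ?thesis using True by (simp add: k_def)
  qed (simp add: k0)
  have "m = (LINT z|lborel. m * indicator {1..2::real} z)" by simp
  also have "\<dots> \<le> integral\<^sup>L lborel (k 1)"
    by (intro integral_mono i1 mk) auto
  finally have K: "0 < integral\<^sup>L lborel (k 1)" using m by simp
  have "integrable lborel (k r) \<and> integral\<^sup>L lborel (k r) = integral\<^sup>L lborel (k 1) * r powr a" if "r \<ge> 0" for r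
  proof (cases "r = 0")
    case True
    then have "k r = (\<lambda>_. 0)" by (auto simp: k_def fun_eq_iff)
    then show ?thesis using True by simp
  next
    case False
    with that have r: "r > 0" by simp
    have "r powr (1 + a) * k 1 (0 + r * z) = k r z" for z
    proof (cases "z > 0")
      case True
      have "r powr (1 + a) * (r * z) powr (- 1 - a) = z powr (- 1 - a)"
        using r True by (simp add: powr_mult powr_add[symmetric] mult.assoc[symmetric])
      then show ?thesis using True r by (simp add: k_def ac_simps)
    qed (use r in \<open>auto simp: k_def indicator_def zero_less_mult_iff\<close>)
    then have eq: "k r = (\<lambda>z. r powr (1 + a) * k 1 (0 + r * z))" by auto
    have "integrable lborel (k r)"
      unfolding eq using lborel_integrable_real_affine[OF i1, of r 0] r by simp
    moreover have "integral\<^sup>L lborel (k r) = r powr (1 + a) * (integral\<^sup>L lborel (k 1) / r)"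
      unfolding eq using lborel_integral_real_affine[of r "k 1" 0] r by simp
    moreover have "r powr (1 + a) * (integral\<^sup>L lborel (k 1) / r) = integral\<^sup>L lborel (k 1) * r powr a"
      using r by (simp add: powr_add)
    ultimately show ?thesis by simp
  qed
  with K show ?thesis by blast
qed

text \<open>The Levy density has infinite mass at 0. Cutting it off below \<open>1 / (n + 1)\<close>
  leaves a finite measure \<open>h n\<close>, for which the exponent splits: the mass gives a
  constant factor, the rest is the exponential of a Laplace transform. Removing the cutoff recovers
  \<open>r powr a\<close>, and \<open>c = t / K\<close> normalizes the exponent.\<close>

lemma gaussian_positive_exp_powr:
  assumes a: "0 < a" "a < 1" and t: "0 \<le> t"
  shows "gaussian_positive TYPE('a::euclidean_space) (\<lambda>r. exp (- t * r powr a))"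
proof -
  define k where "k = (\<lambda>r z::real. indicator {0<..} z * ((1 - exp (- z * r)) * z powr (- 1 - a)))"
  obtain K where K: "K > 0" and k: "\<And>r. r \<ge> 0 \<Longrightarrow> integrable lborel (k r)"
      "\<And>r. r \<ge> 0 \<Longrightarrow> integral\<^sup>L lborel (k r) = K * r powr a"
    using subordination_integral[OF a] unfolding k_def by blast
  define h where "h = (\<lambda>n z. indicator {1 / real (Suc n)..} z * z powr (- 1 - a))"
  have h: "integrable lborel (h n)" "0 \<le> h n z" "z < 0 \<Longrightarrow> h n z = 0" for n :: nat and z
  proof -
    show "integrable lborel (h n)" unfolding h_def
      by (rule integrable_powr_to_inf) (use a in auto)
    have "1 / real (Suc n) > 0" by simp
    then have "\<not> 1 / real (Suc n) \<le> z" if "z < 0" using that by linarith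
    then show "z < 0 \<Longrightarrow> h n z = 0" unfolding h_def by simp
  qed (simp add: h_def)
  have [measurable]: "h n \<in> borel_measurable borel" for n
    unfolding h_def by measurable
  have [measurable]: "k r \<in> borel_measurable borel" for r
    unfolding k_def by measurable
  let ?g = "\<lambda>n r. LINT z|lborel. exp (- z * r) * h n z"
  define c where "c = t / K"
  have c: "c \<ge> 0" using t K by (simp add: c_def)
  \<comment> \<open>\<open>?g n 0\<close> is the mass of \<open>h n\<close>, so \<open>F n r\<close>
    is the exponential of \<open>- c\<close> times the integral of
    \<open>(1 - exp (- z * r)) * h n z\<close>; in particular it is at most 1.\<close>
  define F where "F = (\<lambda>n r. exp (- c * ?g n 0) * exp (c * ?g n r))"
  have F: "gaussian_positive TYPE('a) (F n)" for n
    unfolding F_def by (intro gaussian_positive_cmult gaussian_positive_exp_laplace h c) auto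
  have hexp: "exp (- z * r) * h n z \<le> h n z" if "r \<ge> 0" for r z n
    using h(2)[of n z] h(3)[of z n] that by (cases "z < 0") (auto simp: mult_left_le_one_le)
  have inth: "integrable lborel (\<lambda>z. exp (- z * r) * h n z)" if "r \<ge> 0" for r n
    by (rule Bochner_Integration.integrable_bound[OF h(1)]) (use hexp[OF that] h(2) in auto)
  have F_eq: "F n r = exp (- c * (LINT z|lborel. h n z - exp (- z * r) * h n z))" if "r \<ge> 0" for n r
    unfolding F_def by (subst Bochner_Integration.integral_diff[OF h(1) inth[OF that]])
      (simp add: mult_exp_exp algebra_simps)
  show ?thesis
  proof (rule gaussian_positive_limit[OF F])
    fix n and r :: real assume r: "0 \<le> r"
    have "0 \<le> (LINT z|lborel. h n z - exp (- z * r) * h n z)"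
      using hexp[OF r] by (intro Bochner_Integration.integral_nonneg) auto
    then show "\<bar>F n r\<bar> \<le> 1" using c by (simp add: F_eq[OF r])
  next
    fix r :: real assume r: "0 \<le> r"
    have "(\<lambda>n. LINT z|lborel. h n z - exp (- z * r) * h n z) \<longlonglongrightarrow> integral\<^sup>L lborel (k r)"
    proof (rule integral_dominated_convergence)
      show "integrable lborel (k r)" by (rule k[OF r])
      have hk: "h n z - exp (- z * r) * h n z = indicator {1 / real (Suc n)..} z * k r z" for n z
      proof -
        have "1 / real (Suc n) > 0" by simp
        then have "1 / real (Suc n) \<le> z \<Longrightarrow> 0 < z" by linarith
        then show ?thesis by (auto simp: h_def k_def indicator_def algebra_simps simp del: of_nat_Suc)
      qed
      have k0: "0 \<le> k r z" for z using r by (auto simp: k_def indicator_def intro!: mult_nonneg_nonneg)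
      show "AE z in lborel. norm (h n z - exp (- z * r) * h n z) \<le> k r z" for n
        unfolding hk using k0 by (intro AE_I2) (auto simp: indicator_def)
      show "AE z in lborel. (\<lambda>n. h n z - exp (- z * r) * h n z) \<longlonglongrightarrow> k r z"
      proof (rule AE_I2)
        fix z
        show "(\<lambda>n. h n z - exp (- z * r) * h n z) \<longlonglongrightarrow> k r z"
        proof (cases "z > 0")
          case True
          then obtain N where N: "inverse (real (Suc N)) < z" using reals_Archimedean by blast
          have "1 / real (Suc n) \<le> z" if "n \<ge> N" for n
          proof -
            have "1 / real (Suc n) \<le> 1 / real (Suc N)" using that by (intro divide_left_mono) auto
            then show ?thesis using N by (simp add: inverse_eq_divide)
          qed
          then have "\<forall>\<^sub>F n in sequentially. k r z = h n z - exp (- z * r) * h n z"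
            unfolding hk by (auto simp: eventually_sequentially simp del: of_nat_Suc intro!: exI[of _ N])
          then show ?thesis by (rule Lim_transform_eventually[OF tendsto_const])
        next
          case False
          then show ?thesis unfolding hk by (simp add: k_def)
        qed
      qed
    qed measurable
    then have "(\<lambda>n. F n r) \<longlonglongrightarrow> exp (- c * integral\<^sup>L lborel (k r))"
      unfolding F_eq[OF r] by (intro tendsto_intros)
    also have "- c * integral\<^sup>L lborel (k r) = - t * r powr a"
      using K by (simp add: k(2)[OF r] c_def)
    finally show "(\<lambda>n. F n r) \<longlonglongrightarrow> exp (- t * r powr a)" .
  qed measurable
qed

section \<open>Non-negativity of the kernel\<close>

lemma borel_measurable_cis[measurable]: "cis \<in> borel_measurable borel"
  by (intro borel_measurable_continuous_onI continuous_intros)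

lemma integrable_cis_mult:
  assumes "integrable lborel f"
  shows "integrable lborel (\<lambda>\<xi>::'a::euclidean_space. cis (x \<bullet> \<xi>) * complex_of_real (f \<xi>))"
  using borel_measurable_integrable[OF assms]
  by (intro Bochner_Integration.integrable_bound[OF assms]) (auto simp: norm_mult)

lemma stable_density_eq_cos:
  fixes x :: "'a::euclidean_space"
  assumes "0 < \<alpha>" "0 < t"
  shows "stable_density \<alpha> t x = (LINT \<xi>|lborel. cos (x \<bullet> \<xi>) * exp (- t * norm \<xi> powr \<alpha>)) / (2 * pi) ^ DIM('a)"
proof -
  have "integrable lborel (\<lambda>\<xi>. cis (x \<bullet> \<xi>) * complex_of_real (exp (- t * norm \<xi> powr \<alpha>)))"
    by (rule integrable_cis_mult[OF integrable_exp_powr[OF assms(2,1)]])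
  then show ?thesis unfolding stable_density_def by (subst integral_Re[symmetric]) simp_all
qed

text \<open>The symbol is a function of |\<xi>|^2 with exponent \<alpha>/2. The auxiliary Gaussian
  factor is removed by dominated convergence with \<open>s = 1 / (n + 1)\<close>.\<close>

lemma stable_density_nonneg:
  fixes x :: "'a::euclidean_space"
  assumes \<alpha>: "0 < \<alpha>" "\<alpha> \<le> 2" and t: "0 < t"
  shows "0 \<le> stable_density \<alpha> t x"
proof -
  \<comment> \<open>For \<open>\<alpha> = 2\<close> the exponent \<open>\<alpha> / 2\<close> equals
    1, which subordination excludes, but the function is then a plain exponential.\<close>
  have gp: "gaussian_positive TYPE('a) (\<lambda>r. exp (- t * r powr (\<alpha> / 2)))"
  proof (cases "\<alpha> = 2")
    case True
    have "gaussian_positive TYPE('a) (\<lambda>r. exp (- t * r))"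
      using gaussian_positive_exp[of t] t by simp
    then show ?thesis unfolding True gaussian_positive_def by (simp cong: conj_cong)
  next
    case False
    then show ?thesis using \<alpha> t by (intro gaussian_positive_exp_powr) auto
  qed
  have sq: "((norm \<xi>)\<^sup>2) powr (\<alpha> / 2) = norm \<xi> powr \<alpha>" for \<xi> :: 'a
    by (cases "\<xi> = 0") (simp_all add: powr_powr flip: powr_numeral)
  have "0 \<le> (LINT \<xi>|lborel. cos (x \<bullet> \<xi>) * exp (- t * norm \<xi> powr \<alpha>))"
  proof (rule LIMSEQ_le_const)
    let ?s = "\<lambda>n. inverse (real (Suc n))"
    show "(\<lambda>n. LINT \<xi>|lborel. cos (x \<bullet> \<xi>) * exp (- t * norm \<xi> powr \<alpha>) * exp (- ?s n * (norm \<xi>)\<^sup>2))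
        \<longlonglongrightarrow> (LINT \<xi>|lborel. cos (x \<bullet> \<xi>) * exp (- t * norm \<xi> powr \<alpha>))"
    proof (rule integral_dominated_convergence)
      show "integrable lborel (\<lambda>\<xi>::'a. exp (- t * norm \<xi> powr \<alpha>))"
        by (rule integrable_exp_powr) fact+
      have "(\<lambda>n. cos (x \<bullet> \<xi>) * exp (- t * norm \<xi> powr \<alpha>) * exp (- ?s n * (norm \<xi>)\<^sup>2))
          \<longlonglongrightarrow> cos (x \<bullet> \<xi>) * exp (- t * norm \<xi> powr \<alpha>) * exp (- 0 * (norm \<xi>)\<^sup>2)" for \<xi>
        by (intro tendsto_intros LIMSEQ_inverse_real_of_nat)
      then show "AE \<xi> in lborel. (\<lambda>n. cos (x \<bullet> \<xi>) * exp (- t * norm \<xi> powr \<alpha>) * exp (- ?s n * (norm \<xi>)\<^sup>2))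
          \<longlonglongrightarrow> cos (x \<bullet> \<xi>) * exp (- t * norm \<xi> powr \<alpha>)"
        by simp
      show "AE \<xi> in lborel. norm (cos (x \<bullet> \<xi>) * exp (- t * norm \<xi> powr \<alpha>) * exp (- ?s n * (norm \<xi>)\<^sup>2))
          \<le> exp (- t * norm \<xi> powr \<alpha>)" for n
      proof (rule AE_I2)
        fix \<xi> :: 'a
        have "\<bar>cos (x \<bullet> \<xi>)\<bar> * exp (- ?s n * (norm \<xi>)\<^sup>2) \<le> 1 * 1" by (rule mult_mono) auto
        from mult_right_mono[OF this, of "exp (- t * norm \<xi> powr \<alpha>)"]
        show "norm (cos (x \<bullet> \<xi>) * exp (- t * norm \<xi> powr \<alpha>) * exp (- ?s n * (norm \<xi>)\<^sup>2))
          \<le> exp (- t * norm \<xi> powr \<alpha>)" by (simp add: abs_mult ac_simps)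
      qed
    qed measurable
    show "\<exists>N. \<forall>n\<ge>N. 0 \<le> (LINT \<xi>|lborel. cos (x \<bullet> \<xi>) * exp (- t * norm \<xi> powr \<alpha>) * exp (- ?s n * (norm \<xi>)\<^sup>2))"
      using gp unfolding gaussian_positive_def sq by (auto simp del: of_nat_Suc)
  qed
  then show ?thesis using \<alpha> t by (simp add: stable_density_eq_cos)
qed

section \<open>Fourier inversion and the convolution identity\<close>

lemma integral_lborel_affine:
  fixes f :: "'a::euclidean_space \<Rightarrow> 'b::{banach,second_countable_topology}"
  assumes [measurable]: "f \<in> borel_measurable borel" and c: "c \<noteq> 0"
  shows "integral\<^sup>L lborel f = \<bar>c\<bar> ^ DIM('a) *\<^sub>R (LINT x|lborel. f (t + c *\<^sub>R x))"
proof -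
  have "integral\<^sup>L lborel f = integral\<^sup>L (density (distr lborel borel (\<lambda>x. t + c *\<^sub>R x)) (\<lambda>_. \<bar>c\<bar> ^ DIM('a))) f"
    by (simp only: lborel_affine[OF c, of t, symmetric])
  also have "\<dots> = \<bar>c\<bar> ^ DIM('a) *\<^sub>R (LINT x|lborel. f (t + c *\<^sub>R x))"
    by (simp add: integral_density integral_distr)
  finally show ?thesis .
qed

lemma borel_measurable_stable_density[measurable (raw)]:
  fixes g :: "'b \<Rightarrow> 'a::euclidean_space"
  assumes [measurable]: "f \<in> borel_measurable M" "g \<in> borel_measurable M"
  shows "(\<lambda>w. stable_density \<alpha> (f w) (g w)) \<in> borel_measurable M"
  unfolding stable_density_def by measurable

lemma stable_density_minus: "stable_density \<alpha> t (- x) = stable_density \<alpha> t x"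
proof -
  let ?f = "\<lambda>\<xi>::'a. cis (x \<bullet> \<xi>) * complex_of_real (exp (- t * norm \<xi> powr \<alpha>))"
  have "integral\<^sup>L lborel ?f = (LINT \<xi>|lborel. ?f (0 + (-1) *\<^sub>R \<xi>))"
    by (subst integral_lborel_affine[of ?f "-1" 0]) simp_all
  then show ?thesis unfolding stable_density_def by simp
qed

context
  fixes \<alpha> :: real
  assumes \<alpha>: "0 < \<alpha>" "\<alpha> \<le> 2"
begin

text \<open>Reflecting \<xi> conjugates the integrand, so the integral is real. This removes the
  \<open>Re\<close> of the definition and makes the formula usable inside complex Fubini
  arguments.\<close>

lemma stable_density_fourier:
  fixes x :: "'a::euclidean_space"
  assumes t: "0 < t"
  shows "complex_of_real (stable_density \<alpha> t x) =
     (LINT \<xi>|lborel. cis (x \<bullet> \<xi>) * of_real (exp (- t * norm \<xi> powr \<alpha>))) / of_real ((2 * pi) ^ DIM('a))"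
proof -
  let ?f = "\<lambda>\<xi>. cis (x \<bullet> \<xi>) * complex_of_real (exp (- t * norm \<xi> powr \<alpha>))"
  have real: "Im z = Im (cnj z) \<Longrightarrow> z = of_real (Re z)" for z
    by (simp add: complex_eq_iff)
  have "integral\<^sup>L lborel ?f = (LINT \<xi>|lborel. ?f (0 + (-1) *\<^sub>R \<xi>))"
    by (subst integral_lborel_affine[of ?f "-1" 0]) simp_all
  also have "\<dots> = (LINT \<xi>|lborel. cnj (?f \<xi>))"
    by (intro Bochner_Integration.integral_cong) (simp_all add: cis_cnj)
  also have "\<dots> = cnj (integral\<^sup>L lborel ?f)"
    by (rule Bochner_Integration.integral_cnj)
  finally have "Im (integral\<^sup>L lborel ?f) = Im (cnj (integral\<^sup>L lborel ?f))"
    by (rule arg_cong)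
  then have I: "integral\<^sup>L lborel ?f = of_real (Re (integral\<^sup>L lborel ?f))"
    by (rule real)
  show ?thesis unfolding stable_density_def of_real_divide by (subst I[symmetric]) (rule refl)
qed

lemma stable_density_le_integral:
  fixes x :: "'a::euclidean_space"
  assumes t: "0 < t"
  shows "stable_density \<alpha> t x \<le> (LINT \<xi>|lborel. exp (- t * norm (\<xi>::'a) powr \<alpha>)) / (2 * pi) ^ DIM('a)"
proof -
  have "(LINT \<xi>|lborel. cos (x \<bullet> \<xi>) * exp (- t * norm (\<xi>::'a) powr \<alpha>)) \<le> (LINT \<xi>|lborel. exp (- t * norm (\<xi>::'a) powr \<alpha>))"
    using integrable_exp_powr[OF t \<alpha>(1), where 'a='a]
    by (intro integral_mono Bochner_Integration.integrable_bound[OF integrable_exp_powr[OF t \<alpha>(1), where 'a='a]])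
       (auto simp: abs_mult mult_left_le_one_le)
  then show ?thesis using t \<alpha> by (simp add: stable_density_eq_cos divide_right_mono)
qed

lemma stable_density_zero:
  assumes t: "0 < t"
  shows "stable_density \<alpha> t (0::'a::euclidean_space) = (LINT \<xi>|lborel. exp (- t * norm (\<xi>::'a) powr \<alpha>)) / (2 * pi) ^ DIM('a)"
  using t \<alpha> by (simp add: stable_density_eq_cos)

text \<open>Rescaling the frequency by \<open>c\<close> with \<open>t * c powr \<alpha> = 1\<close>
  gives equality at \<open>x = 0\<close>, where the density has its maximum because the cosine is at
  most 1.\<close>

lemma stable_density_le:
  fixes x :: "'a::euclidean_space"
  assumes t: "0 < t"
  shows "t powr (DIM('a) / \<alpha>) * stable_density \<alpha> t x \<le> stable_density \<alpha> 1 (0::'a)"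
proof -
  define c where "c = t powr (- 1 / \<alpha>)"
  have c: "c > 0" using t by (simp add: c_def)
  have tc: "t * c powr \<alpha> = 1" 
  proof -
    have "c powr \<alpha> = t powr (- 1)" unfolding c_def powr_powr using \<alpha> by simp
    then show ?thesis using t by (simp add: powr_minus)
  qed
  have cd: "t powr (DIM('a) / \<alpha>) * c ^ DIM('a) = 1"
    unfolding powr_realpow[OF c, symmetric] unfolding c_def powr_powr powr_add[symmetric] using t by simp
  let ?f = "\<lambda>\<xi>::'a. exp (- t * norm \<xi> powr \<alpha>)"
  have "integral\<^sup>L lborel ?f = c ^ DIM('a) * (LINT \<xi>|lborel. ?f (0 + c *\<^sub>R \<xi>))"
    using c by (subst integral_lborel_affine[of ?f c 0]) simp_all
  also have "(\<lambda>\<xi>. ?f (0 + c *\<^sub>R \<xi>)) = (\<lambda>\<xi>. exp (- 1 * norm \<xi> powr \<alpha>))"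
    using c tc by (simp add: powr_mult mult.assoc[symmetric])
  finally have "t powr (DIM('a) / \<alpha>) * integral\<^sup>L lborel ?f = (t powr (DIM('a) / \<alpha>) * c ^ DIM('a)) * (LINT \<xi>|lborel. exp (- 1 * norm (\<xi>::'a) powr \<alpha>))"
    by simp
  then have "t powr (DIM('a) / \<alpha>) * (integral\<^sup>L lborel ?f / (2 * pi) ^ DIM('a)) = stable_density \<alpha> 1 (0::'a)"
    unfolding cd by (simp add: stable_density_zero)
  moreover have "t powr (DIM('a) / \<alpha>) * stable_density \<alpha> t x \<le> t powr (DIM('a) / \<alpha>) * (integral\<^sup>L lborel ?f / (2 * pi) ^ DIM('a))"
    by (intro mult_left_mono stable_density_le_integral t) simp
  ultimately show ?thesis by simp
qed

text \<open>The damping in \<open>y\<close> makes the double integral absolutely convergent before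
  anything is known about integrability of the density. The right-hand side is a Gaussian average of
  the symbol around \<open>- \<eta>\<close> at scale \<open>sqrt \<delta>\<close>, so that
  \<open>\<delta>\<close> tending to 0 will give Fourier inversion.\<close>

lemma stable_density_gaussian_regularization:
  fixes \<eta> :: "'a::euclidean_space"
  assumes t: "0 < t" and \<delta>: "0 < \<delta>"
  shows "(LINT y|lborel. cis (y \<bullet> \<eta>) * of_real (stable_density \<alpha> t y * exp (- \<delta> * (norm y)\<^sup>2))) =
    complex_of_real ((LINT z|lborel. exp (- t * norm ((2 * sqrt \<delta>) *\<^sub>R z - \<eta>) powr \<alpha>) * exp (- 1 * (norm z)\<^sup>2)) / sqrt pi ^ DIM('a))"
proof -
  let ?e = "\<lambda>\<xi>::'a. exp (- t * norm \<xi> powr \<alpha>)"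
  let ?d = "DIM('a)"
  define F where "F = (\<lambda>y \<xi>::'a. cis (y \<bullet> (\<xi> + \<eta>)) * complex_of_real (?e \<xi> * exp (- \<delta> * (norm y)\<^sup>2)))"
  have int: "integrable (lborel \<Otimes>\<^sub>M lborel) (case_prod F)"
  proof (rule integrable_lborel_pair_bound[OF _ integrable_gaussian[OF \<delta>] integrable_exp_powr[OF t \<alpha>(1)]])
    show "case_prod F \<in> borel_measurable (lborel \<Otimes>\<^sub>M lborel)" unfolding F_def by measurable
  qed (simp add: F_def norm_mult)
  have "(LINT y|lborel. cis (y \<bullet> \<eta>) * of_real (stable_density \<alpha> t y * exp (- \<delta> * (norm y)\<^sup>2)))
    = (LINT y|lborel. (LINT \<xi>|lborel. F y \<xi>) / of_real ((2 * pi) ^ ?d))"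
  proof (rule Bochner_Integration.integral_cong[OF refl])
    fix y :: 'a
    have F: "F y \<xi> = (cis (y \<bullet> \<eta>) * of_real (exp (- \<delta> * (norm y)\<^sup>2))) * (cis (y \<bullet> \<xi>) * of_real (?e \<xi>))" for \<xi>
      by (simp add: F_def inner_add_right cis_mult[symmetric] ac_simps)
    show "cis (y \<bullet> \<eta>) * of_real (stable_density \<alpha> t y * exp (- \<delta> * (norm y)\<^sup>2)) = (LINT \<xi>|lborel. F y \<xi>) / of_real ((2 * pi) ^ ?d)"
      unfolding F integral_mult_right_zero of_real_mult stable_density_fourier[OF t] by simp
  qed
  also have "\<dots> = (LINT y|lborel. LINT \<xi>|lborel. F y \<xi>) / of_real ((2 * pi) ^ ?d)"
    by simp
  also have "(LINT y|lborel. LINT \<xi>|lborel. F y \<xi>) = (LINT \<xi>|lborel. LINT y|lborel. F y \<xi>)"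
    by (rule lborel_pair.Fubini_integral[OF int, symmetric])
  also have "\<dots> = (LINT \<xi>|lborel. complex_of_real (?e \<xi> * (sqrt (pi / \<delta>) ^ ?d * exp (- (norm (\<xi> + \<eta>))\<^sup>2 / (4 * \<delta>)))))"
  proof (rule Bochner_Integration.integral_cong[OF refl])
    fix \<xi> :: 'a
    have F: "F y \<xi> = of_real (?e \<xi>) * (cis ((\<xi> + \<eta>) \<bullet> y) * of_real (exp (- \<delta> * (norm y)\<^sup>2)))" for y
      by (simp add: F_def inner_commute ac_simps)
    show "(LINT y|lborel. F y \<xi>) = complex_of_real (?e \<xi> * (sqrt (pi / \<delta>) ^ ?d * exp (- (norm (\<xi> + \<eta>))\<^sup>2 / (4 * \<delta>))))"
      unfolding F integral_mult_right_zero of_real_mult[of "?e \<xi>"]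
        has_bochner_integral_integral_eq[OF integral_gaussian_char[OF \<delta>]] ..
  qed
  also have "\<dots> = complex_of_real (LINT \<xi>|lborel. ?e \<xi> * (sqrt (pi / \<delta>) ^ ?d * exp (- (norm (\<xi> + \<eta>))\<^sup>2 / (4 * \<delta>))))"
    by (rule integral_complex_of_real)
  \<comment> \<open>The substitution
    \<open>\<xi> = - \<eta> + (2 * sqrt \<delta>) *\<^sub>R z\<close> turns the exponent
    \<open>(norm (\<xi> + \<eta>))\<^sup>2 / (4 * \<delta>)\<close> into
    \<open>(norm z)\<^sup>2\<close>.\<close>
  also have "(LINT \<xi>|lborel. ?e \<xi> * (sqrt (pi / \<delta>) ^ ?d * exp (- (norm (\<xi> + \<eta>))\<^sup>2 / (4 * \<delta>))))
     = (2 * sqrt \<delta>) ^ ?d * (LINT z|lborel. ?e (- \<eta> + (2 * sqrt \<delta>) *\<^sub>R z) * (sqrt (pi / \<delta>) ^ ?d * exp (- (norm ((- \<eta> + (2 * sqrt \<delta>) *\<^sub>R z) + \<eta>))\<^sup>2 / (4 * \<delta>))))"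
    using \<delta> by (subst integral_lborel_affine[of _ "2 * sqrt \<delta>" "- \<eta>"]) simp_all
  also have "\<dots> = (2 * sqrt \<delta>) ^ ?d * (LINT z|lborel. sqrt (pi / \<delta>) ^ ?d * (?e ((2 * sqrt \<delta>) *\<^sub>R z - \<eta>) * exp (- 1 * (norm z)\<^sup>2)))"
    using \<delta> by (simp add: power_mult_distrib ac_simps)
  also have "\<dots> = ((2 * sqrt \<delta>) * sqrt (pi / \<delta>)) ^ ?d * (LINT z|lborel. ?e ((2 * sqrt \<delta>) *\<^sub>R z - \<eta>) * exp (- 1 * (norm z)\<^sup>2))"
    unfolding integral_mult_right_zero power_mult_distrib by simp
  \<comment> \<open>Written with \<open>pi / sqrt pi\<close> so that division by
    \<open>(2 * pi) ^ ?d\<close> leaves the normalization \<open>1 / sqrt pi ^ ?d\<close>.\<close>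
  also have "(2 * sqrt \<delta>) * sqrt (pi / \<delta>) = 2 * (pi / sqrt pi)"
    using \<delta> by (simp add: real_sqrt_divide real_div_sqrt)
  finally show ?thesis by (simp add: power_divide)
qed

text \<open>At \<open>\<eta> = 0\<close> the regularized integral is a Gaussian average of values at
  most 1. Since the density is non-negative, the damped integrands increase as the damping vanishes,
  and monotone convergence applies without prior integrability; this is how integrability is
  obtained.\<close>

lemma nn_integral_stable_density_le_1:
  assumes t: "0 < t"
  shows "(\<integral>\<^sup>+ y. ennreal (stable_density \<alpha> t (y::'a::euclidean_space)) \<partial>lborel) \<le> 1"
proof -
  let ?p = "stable_density \<alpha> t :: 'a \<Rightarrow> real"
  let ?s = "\<lambda>n. inverse (real (Suc n))"
  have p0: "0 \<le> ?p y" for y using \<alpha> t by (rule stable_density_nonneg)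
  have sp: "0 < ?s n" for n by simp
  define C where "C = (LINT \<xi>|lborel. exp (- t * norm (\<xi>::'a) powr \<alpha>)) / (2 * pi) ^ DIM('a)"
  have pC: "?p y \<le> C" for y unfolding C_def by (rule stable_density_le_integral[OF t])
  have bd: "(\<integral>\<^sup>+ y. ennreal (?p y * exp (- \<delta> * (norm y)\<^sup>2)) \<partial>lborel) \<le> 1" if \<delta>: "0 < \<delta>" for \<delta>
  proof -
    have int: "integrable lborel (\<lambda>y. ?p y * exp (- \<delta> * (norm y)\<^sup>2))"
    proof (rule Bochner_Integration.integrable_bound)
      show "integrable lborel (\<lambda>y::'a. C * exp (- \<delta> * (norm y)\<^sup>2))"
        using integrable_gaussian[OF \<delta>, where 'a='a] by simp
      show "AE y::'a in lborel. norm (?p y * exp (- \<delta> * (norm y)\<^sup>2)) \<le> norm (C * exp (- \<delta> * (norm y)\<^sup>2))"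
        using p0 pC order_trans[OF p0 pC] by (intro AE_I2) (simp add: abs_mult)
    qed measurable
    have "complex_of_real (LINT y|lborel. ?p y * exp (- \<delta> * (norm y)\<^sup>2)) =
       of_real ((LINT z|lborel. exp (- t * norm ((2 * sqrt \<delta>) *\<^sub>R (z::'a) - 0) powr \<alpha>) * exp (- 1 * (norm z)\<^sup>2)) / sqrt pi ^ DIM('a))"
      using stable_density_gaussian_regularization[OF t \<delta>, of "0::'a"]
      unfolding integral_complex_of_real[symmetric] by simp
    then have "(LINT y|lborel. ?p y * exp (- \<delta> * (norm y)\<^sup>2)) =
       (LINT z|lborel. exp (- t * norm ((2 * sqrt \<delta>) *\<^sub>R (z::'a) - 0) powr \<alpha>) * exp (- 1 * (norm z)\<^sup>2)) / sqrt pi ^ DIM('a)"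
      by (simp only: of_real_eq_iff)
    also have "\<dots> \<le> (LINT z|lborel. exp (- 1 * (norm (z::'a))\<^sup>2)) / sqrt pi ^ DIM('a)"
    proof (intro divide_right_mono integral_mono)
      show g: "integrable lborel (\<lambda>z::'a. exp (- 1 * (norm z)\<^sup>2))" by (rule integrable_gaussian) simp
      show "exp (- t * norm ((2 * sqrt \<delta>) *\<^sub>R z - 0) powr \<alpha>) * exp (- 1 * (norm z)\<^sup>2) \<le> exp (- 1 * (norm z)\<^sup>2)" for z :: 'a
        using t by (intro mult_left_le_one_le) auto
      show "integrable lborel (\<lambda>z::'a. exp (- t * norm ((2 * sqrt \<delta>) *\<^sub>R z - 0) powr \<alpha>) * exp (- 1 * (norm z)\<^sup>2))"
        by (rule Bochner_Integration.integrable_bound[OF g]) (use t in \<open>auto simp: mult_left_le_one_le\<close>)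
    qed simp
    also have "\<dots> = 1" by (subst integral_gaussian) simp_all
    finally have "(LINT y|lborel. ?p y * exp (- \<delta> * (norm y)\<^sup>2)) \<le> 1" .
    then show ?thesis using p0 int by (subst nn_integral_eq_integral) auto
  qed
  have "(\<lambda>n. \<integral>\<^sup>+ y. ennreal (?p y * exp (- ?s n * (norm y)\<^sup>2)) \<partial>lborel) \<longlonglongrightarrow> (\<integral>\<^sup>+ y. ennreal (?p y) \<partial>lborel)"
  proof (rule nn_integral_LIMSEQ)
    show "incseq (\<lambda>n y. ennreal (?p y * exp (- ?s n * (norm y)\<^sup>2)))"
      using p0 by (intro monoI le_funI ennreal_leI mult_left_mono) (auto intro!: mult_right_mono le_imp_inverse_le)
    have "(\<lambda>n. ennreal (?p y * exp (- ?s n * (norm y)\<^sup>2))) \<longlonglongrightarrow> ennreal (?p y * exp (- 0 * (norm y)\<^sup>2))" for y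
      by (intro tendsto_intros LIMSEQ_inverse_real_of_nat)
    then show "(\<lambda>n. ennreal (?p y * exp (- ?s n * (norm y)\<^sup>2))) \<longlonglongrightarrow> ennreal (?p y)" for y
      by simp
  qed measurable
  then show ?thesis
    by (rule LIMSEQ_le_const2) (use bd[OF sp] in blast)
qed

lemma integrable_stable_density:
  assumes t: "0 < t"
  shows "integrable lborel (stable_density \<alpha> t :: 'a::euclidean_space \<Rightarrow> real)"
proof (rule integrableI_nonneg)
  show "(\<integral>\<^sup>+ y. ennreal (stable_density \<alpha> t (y::'a)) \<partial>lborel) < \<infinity>"
    using nn_integral_stable_density_le_1[OF t, where 'a='a] by (simp add: le_less_trans)
qed (use stable_density_nonneg[OF \<alpha> t] in auto)

text \<open>Both sides of the regularized formula converge as the damping vanishes: the left with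
  the density itself as majorant, the right by continuity of the symbol at
  \<open>\<eta>\<close>.\<close>

lemma stable_density_char:
  fixes \<eta> :: "'a::euclidean_space"
  assumes t: "0 < t"
  shows "(LINT y|lborel. cis (y \<bullet> \<eta>) * of_real (stable_density \<alpha> t y)) = complex_of_real (exp (- t * norm \<eta> powr \<alpha>))"
proof (rule LIMSEQ_unique)
  let ?p = "stable_density \<alpha> t :: 'a \<Rightarrow> real"
  let ?s = "\<lambda>n. inverse (real (Suc n))"
  have p0: "0 \<le> ?p y" for y using \<alpha> t by (rule stable_density_nonneg)
  have sp: "0 < ?s n" for n by simp
  let ?L = "\<lambda>n. LINT y|lborel. cis (y \<bullet> \<eta>) * of_real (?p y * exp (- ?s n * (norm y)\<^sup>2))"
  show "?L \<longlonglongrightarrow> (LINT y|lborel. cis (y \<bullet> \<eta>) * of_real (?p y))"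
  proof (rule integral_dominated_convergence)
    show "integrable lborel ?p" by (rule integrable_stable_density[OF t])
    have "(\<lambda>n. cis (y \<bullet> \<eta>) * of_real (?p y * exp (- ?s n * (norm y)\<^sup>2)))
        \<longlonglongrightarrow> cis (y \<bullet> \<eta>) * of_real (?p y * exp (- 0 * (norm y)\<^sup>2))" for y
      by (intro tendsto_intros LIMSEQ_inverse_real_of_nat)
    then show "AE y in lborel. (\<lambda>n. cis (y \<bullet> \<eta>) * of_real (?p y * exp (- ?s n * (norm y)\<^sup>2)))
        \<longlonglongrightarrow> cis (y \<bullet> \<eta>) * of_real (?p y)"
      by simp
    show "AE y in lborel. norm (cis (y \<bullet> \<eta>) * of_real (?p y * exp (- ?s n * (norm y)\<^sup>2))) \<le> ?p y" for n
      using p0 by (intro AE_I2) (simp add: norm_mult mult_left_le)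
  qed measurable
  let ?R = "\<lambda>n. LINT z|lborel. exp (- t * norm ((2 * sqrt (?s n)) *\<^sub>R z - \<eta>) powr \<alpha>) * exp (- 1 * (norm (z::'a))\<^sup>2)"
  have R: "?R \<longlonglongrightarrow> (LINT z|lborel. exp (- t * norm \<eta> powr \<alpha>) * exp (- 1 * (norm (z::'a))\<^sup>2))"
  proof (rule integral_dominated_convergence)
    show "integrable lborel (\<lambda>z::'a. exp (- 1 * (norm z)\<^sup>2))" by (rule integrable_gaussian) simp
    \<comment> \<open>For \<open>\<eta> = 0\<close> the base of \<open>powr\<close> tends to 0, so
      continuity there rests on \<open>\<alpha> > 0\<close>.\<close>
    have "(\<lambda>n. exp (- t * norm ((2 * sqrt (?s n)) *\<^sub>R z - \<eta>) powr \<alpha>) * exp (- 1 * (norm z)\<^sup>2))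
       \<longlonglongrightarrow> exp (- t * norm ((2 * sqrt 0) *\<^sub>R z - \<eta>) powr \<alpha>) * exp (- 1 * (norm z)\<^sup>2)" for z :: 'a
      by (intro tendsto_intros LIMSEQ_inverse_real_of_nat tendsto_powr') (use \<alpha> in auto)
    then show "AE z in lborel. (\<lambda>n. exp (- t * norm ((2 * sqrt (?s n)) *\<^sub>R z - \<eta>) powr \<alpha>) * exp (- 1 * (norm z)\<^sup>2))
       \<longlonglongrightarrow> exp (- t * norm \<eta> powr \<alpha>) * exp (- 1 * (norm z)\<^sup>2)"
      by simp
    show "AE z in lborel. norm (exp (- t * norm ((2 * sqrt (?s n)) *\<^sub>R z - \<eta>) powr \<alpha>) * exp (- 1 * (norm z)\<^sup>2))
       \<le> exp (- 1 * (norm z)\<^sup>2)" for n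
      using t by (intro AE_I2) (simp add: mult_left_le_one_le)
  qed measurable
  have lim: "(LINT z|lborel. exp (- t * norm \<eta> powr \<alpha>) * exp (- 1 * (norm (z::'a))\<^sup>2)) / sqrt pi ^ DIM('a) = exp (- t * norm \<eta> powr \<alpha>)"
    unfolding integral_mult_right_zero by (subst integral_gaussian) simp_all
  have "(\<lambda>n. complex_of_real (?R n / sqrt pi ^ DIM('a))) \<longlonglongrightarrow>
      of_real ((LINT z|lborel. exp (- t * norm \<eta> powr \<alpha>) * exp (- 1 * (norm (z::'a))\<^sup>2)) / sqrt pi ^ DIM('a))"
    by (intro tendsto_of_real tendsto_divide R tendsto_const) simp
  then show "?L \<longlonglongrightarrow> of_real (exp (- t * norm \<eta> powr \<alpha>))"
    unfolding stable_density_gaussian_regularization[OF t sp] lim .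
qed

text \<open>Only the first density is expanded as a Fourier integral. The remaining integral over
  \<open>y\<close> is the characteristic function of the second, so the two exponents add. The
  argument \<open>y - x\<close>, as in the integral equation, produces \<open>- x\<close>, which
  symmetry undoes.\<close>

lemma stable_density_convolution:
  fixes x :: "'a::euclidean_space"
  assumes t: "0 < t" and s: "0 < s"
  shows "(\<integral>\<^sup>+ y. ennreal (stable_density \<alpha> t (y - x) * stable_density \<alpha> s y) \<partial>lborel) = ennreal (stable_density \<alpha> (t + s) x)"
proof -
  let ?d = "DIM('a)"
  let ?p = "stable_density \<alpha> :: real \<Rightarrow> 'a \<Rightarrow> real"
  let ?e = "\<lambda>t (\<xi>::'a). exp (- t * norm \<xi> powr \<alpha>)"
  have p0: "0 \<le> ?p t y" "0 \<le> ?p s y" for y using \<alpha> t s by (auto intro: stable_density_nonneg)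
  define F where "F = (\<lambda>y \<xi>::'a. cis ((y - x) \<bullet> \<xi>) * complex_of_real (?e t \<xi> * ?p s y))"
  have int: "integrable (lborel \<Otimes>\<^sub>M lborel) (case_prod F)"
  proof (rule integrable_lborel_pair_bound[OF _ integrable_stable_density[OF s] integrable_exp_powr[OF t \<alpha>(1)]])
    show "case_prod F \<in> borel_measurable (lborel \<Otimes>\<^sub>M lborel)" unfolding F_def by measurable
  qed (simp add: F_def norm_mult p0)
  have "complex_of_real (LINT y|lborel. ?p t (y - x) * ?p s y) = (LINT y|lborel. complex_of_real (?p t (y - x) * ?p s y))"
    by (rule integral_complex_of_real[symmetric])
  also have "\<dots> = (LINT y|lborel. (LINT \<xi>|lborel. F y \<xi>) / of_real ((2 * pi) ^ ?d))"
  proof (rule Bochner_Integration.integral_cong[OF refl])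
    fix y :: 'a
    have F: "F y \<xi> = of_real (?p s y) * (cis ((y - x) \<bullet> \<xi>) * of_real (?e t \<xi>))" for \<xi>
      by (simp add: F_def ac_simps)
    show "complex_of_real (?p t (y - x) * ?p s y) = (LINT \<xi>|lborel. F y \<xi>) / of_real ((2 * pi) ^ ?d)"
      unfolding F integral_mult_right_zero of_real_mult stable_density_fourier[OF t] by simp
  qed
  also have "\<dots> = (LINT y|lborel. LINT \<xi>|lborel. F y \<xi>) / of_real ((2 * pi) ^ ?d)"
    by simp
  also have "(LINT y|lborel. LINT \<xi>|lborel. F y \<xi>) = (LINT \<xi>|lborel. LINT y|lborel. F y \<xi>)"
    by (rule lborel_pair.Fubini_integral[OF int, symmetric])
  also have "\<dots> = (LINT \<xi>|lborel. cis ((- x) \<bullet> \<xi>) * of_real (?e (t + s) \<xi>))"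
  proof (rule Bochner_Integration.integral_cong[OF refl])
    fix \<xi> :: 'a
    have F: "F y \<xi> = (cis ((- x) \<bullet> \<xi>) * of_real (?e t \<xi>)) * (cis (y \<bullet> \<xi>) * of_real (?p s y))" for y
    proof -
      have "cis ((y - x) \<bullet> \<xi>) = cis ((- x) \<bullet> \<xi>) * cis (y \<bullet> \<xi>)" by (simp add: cis_mult inner_diff_left)
      then show ?thesis by (simp add: F_def ac_simps)
    qed
    have ee: "?e (t + s) \<xi> = ?e t \<xi> * ?e s \<xi>" by (simp add: mult_exp_exp algebra_simps)
    show "(LINT y|lborel. F y \<xi>) = cis ((- x) \<bullet> \<xi>) * of_real (?e (t + s) \<xi>)"
      unfolding F integral_mult_right_zero stable_density_char[OF s] ee by simp
  qed
  also have "\<dots> / of_real ((2 * pi) ^ ?d) = complex_of_real (?p (t + s) (- x))"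
    using stable_density_fourier[of "t + s" "- x"] t s by simp
  finally have eq: "(LINT y|lborel. ?p t (y - x) * ?p s y) = ?p (t + s) x"
    by (simp only: of_real_eq_iff stable_density_minus)
  have "integrable lborel (\<lambda>y. ?p t (y - x) * ?p s y)"
  proof (rule Bochner_Integration.integrable_bound)
    define C where "C = (LINT \<xi>|lborel. exp (- t * norm (\<xi>::'a) powr \<alpha>)) / (2 * pi) ^ DIM('a)"
    have pC: "?p t y \<le> C" for y unfolding C_def by (rule stable_density_le_integral[OF t])
    show "integrable lborel (\<lambda>y. C * ?p s y)"
      using integrable_stable_density[OF s, where 'a='a] by simp
    show "AE y in lborel. norm (?p t (y - x) * ?p s y) \<le> norm (C * ?p s y)"
      using p0 pC order_trans[OF p0(1) pC] by (intro AE_I2) (simp add: abs_mult mult_right_mono)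
  qed measurable
  then show ?thesis using p0 by (subst nn_integral_eq_integral) (auto simp: eq)
qed

lemma nn_integral_stable_density_translate_le_1:
  fixes x :: "'a::euclidean_space"
  assumes t: "0 < t"
  shows "(\<integral>\<^sup>+ y. ennreal (stable_density \<alpha> t (y - x)) \<partial>lborel) \<le> 1"
proof -
  have "(\<integral>\<^sup>+ y. ennreal (stable_density \<alpha> t (y - x)) \<partial>lborel) =
     (\<integral>\<^sup>+ y. ennreal (stable_density \<alpha> t (y - x)) \<partial>distr lborel borel ((+) x))"
    by (simp only: lborel_distr_plus)
  also have "\<dots> = (\<integral>\<^sup>+ y. ennreal (stable_density \<alpha> t (y::'a)) \<partial>lborel)"
    by (subst nn_integral_distr) simp_all
  finally show ?thesis using nn_integral_stable_density_le_1[OF t, where 'a='a] by simp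
qed

end

section \<open>The Duhamel operator and the supersolution\<close>

text \<open>
  The right-hand side is the value at \<open>t\<close> of \<open>s\<^bsup>\<sigma>+1\<^esup> (1 + s)\<^bsup>\<delta>-\<sigma>-1\<^esup>\<close>, up to \<open>(t/(1+t))\<^bsup>\<sigma>+1\<^esup> \<le> 1\<close>; the derivative of
  this function dominates \<open>min (\<sigma> + 1) \<delta>\<close> times the integrand.
\<close>

lemma nn_integral_weight_le:
  fixes \<sigma> \<delta> t :: real
  assumes \<sigma>: "\<sigma> > -1" and \<delta>: "\<delta> > 0" and t: "t > 0"
  shows "(\<integral>\<^sup>+ s\<in>{0<..<t}. ennreal (s powr \<sigma> * (1 + s) powr (\<delta> - \<sigma> - 1)) \<partial>lborel)
           \<le> ennreal ((1 + t) powr \<delta> / min (\<sigma> + 1) \<delta>)"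
proof -
  define m where "m = min (\<sigma> + 1) \<delta>"
  have m: "m > 0" using \<sigma> \<delta> by (simp add: m_def)
  define F where "F = (\<lambda>s. s powr (\<sigma> + 1) * (1 + s) powr (\<delta> - \<sigma> - 1))"
  define f where "f = (\<lambda>s. s powr \<sigma> * (1 + s) powr (\<delta> - \<sigma> - 2) * ((\<sigma> + 1) + s * \<delta>))"
  have f0: "0 \<le> f s" if "s \<ge> 0" for s
    using that \<sigma> \<delta> by (simp add: f_def)
  \<comment> \<open>For \<open>\<sigma> < 0\<close> the derivative blows up at 0, so it is used only
    in the interior; \<open>F\<close> is still continuous at 0 because
    \<open>\<sigma> + 1 > 0\<close>.\<close>
  have "(f has_integral (F t - F 0)) {0..t}"
  proof (rule fundamental_theorem_of_calculus_interior)
    show "continuous_on {0..t} F" unfolding F_def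
      using \<sigma> by (intro continuous_on_mult continuous_on_powr' continuous_intros) auto
    fix s assume s: "s \<in> {0<..<t}"
    have e1: "s powr (\<sigma> + 1) = s powr \<sigma> * s" using s by (simp add: powr_add)
    have e2: "(1 + s) powr (\<delta> - \<sigma> - 1) = (1 + s) powr (\<delta> - \<sigma> - 2) * (1 + s)"
      using s powr_add[of "1 + s" "\<delta> - \<sigma> - 2" 1] by simp
    have "(F has_real_derivative ((\<sigma> + 1) * s powr \<sigma> * (1 + s) powr (\<delta> - \<sigma> - 1)
        + s powr (\<sigma> + 1) * ((\<delta> - \<sigma> - 1) * (1 + s) powr (\<delta> - \<sigma> - 2)))) (at s)"
      unfolding F_def using s by (auto intro!: derivative_eq_intros simp: algebra_simps)
    also have "(\<sigma> + 1) * s powr \<sigma> * (1 + s) powr (\<delta> - \<sigma> - 1)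
        + s powr (\<sigma> + 1) * ((\<delta> - \<sigma> - 1) * (1 + s) powr (\<delta> - \<sigma> - 2)) = f s"
      unfolding f_def e1 e2 by (simp add: algebra_simps)
    finally show "(F has_vector_derivative f s) (at s)"
      by (simp add: has_real_derivative_iff_has_vector_derivative)
  qed (use t in simp)
  then have I: "(\<integral>\<^sup>+ s. ennreal (f s) * indicator {0..t} s \<partial>lborel) = ennreal (F t - F 0)"
    by (intro nn_integral_has_integral_lebesgue') (use f0 in auto)
  have "(\<integral>\<^sup>+ s\<in>{0<..<t}. ennreal (s powr \<sigma> * (1 + s) powr (\<delta> - \<sigma> - 1)) \<partial>lborel)
     \<le> (\<integral>\<^sup>+ s. ennreal (1 / m) * (ennreal (f s) * indicator {0..t} s) \<partial>lborel)"
  proof (rule nn_integral_mono)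
    fix s
    show "ennreal (s powr \<sigma> * (1 + s) powr (\<delta> - \<sigma> - 1)) * indicator {0<..<t} s
       \<le> ennreal (1 / m) * (ennreal (f s) * indicator {0..t} s)"
    proof (cases "s \<in> {0<..<t}")
      case True
      have "(1 + s) powr (\<delta> - \<sigma> - 1) = (1 + s) powr (\<delta> - \<sigma> - 2) * (1 + s)"
        using True powr_add[of "1 + s" "\<delta> - \<sigma> - 2" 1] by simp
      then have "m * (s powr \<sigma> * (1 + s) powr (\<delta> - \<sigma> - 1)) = s powr \<sigma> * (1 + s) powr (\<delta> - \<sigma> - 2) * (m * (1 + s))"
        by simp
      also have "m * (1 + s) \<le> (\<sigma> + 1) + s * \<delta>"
      proof -
        have "m * s \<le> \<delta> * s" using True by (intro mult_right_mono) (auto simp: m_def)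
        then show ?thesis by (simp add: m_def algebra_simps)
      qed
      then have "s powr \<sigma> * (1 + s) powr (\<delta> - \<sigma> - 2) * (m * (1 + s)) \<le> f s"
        unfolding f_def by (intro mult_left_mono) auto
      finally have "s powr \<sigma> * (1 + s) powr (\<delta> - \<sigma> - 1) \<le> 1 / m * f s"
        using m by (simp add: field_simps)
      then show ?thesis using True m f0[of s] by (simp add: ennreal_mult[symmetric] ennreal_leI)
    qed simp
  qed
  also have "\<dots> = ennreal (1 / m) * ennreal (F t - F 0)"
    unfolding I[symmetric] by (rule nn_integral_cmult) (simp add: f_def)
  also have "\<dots> = ennreal (1 / m * F t)"
    using m by (simp add: F_def ennreal_mult[symmetric])
  also have "\<dots> \<le> ennreal ((1 + t) powr \<delta> / m)"
  proof (rule ennreal_leI)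
    have "F t \<le> (1 + t) powr (\<sigma> + 1) * (1 + t) powr (\<delta> - \<sigma> - 1)"
      unfolding F_def using t \<sigma> by (intro mult_right_mono powr_mono2) auto
    also have "\<dots> = (1 + t) powr \<delta>" by (simp add: powr_add[symmetric])
    finally show "1 / m * F t \<le> (1 + t) powr \<delta> / m" using m by (simp add: divide_right_mono)
  qed
  finally show ?thesis unfolding m_def .
qed

text \<open>The mean value theorem with the derivative bounded on [0,M]. The additive one-sided form
  can be integrated in [0,\<infinity>] without subtraction.\<close>

lemma powr_diff_le:
  fixes a b M :: real
  assumes "0 \<le> a" "a \<le> M" "0 \<le> b" "b \<le> M" "1 < \<beta>"
  shows "a powr \<beta> \<le> b powr \<beta> + \<beta> * M powr (\<beta> - 1) * \<bar>a - b\<bar>"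
proof (cases "a \<le> b")
  case True
  then have "a powr \<beta> \<le> b powr \<beta>" using assms by (intro powr_mono2) auto
  moreover have "0 \<le> \<beta> * M powr (\<beta> - 1) * \<bar>a - b\<bar>" using assms by simp
  ultimately show ?thesis by linarith
next
  case False
  have "continuous_on {b..a} (\<lambda>x. x powr \<beta>)"
    using assms by (intro continuous_on_powr' continuous_intros) auto
  then obtain z where z: "b < z" "z < a" "a powr \<beta> - b powr \<beta> = \<beta> * z powr (\<beta> - 1) * (a - b)"
  proof (rule mvt[rotated])
    show "((\<lambda>x. x powr \<beta>) has_derivative (*) (\<beta> * z powr (\<beta> - 1))) (at z)" if "b < z" "z < a" for z
      using has_real_derivative_powr[of z \<beta>] that assms by (simp add: has_field_derivative_def)
  qed (use False in auto)
  have "\<beta> * z powr (\<beta> - 1) * (a - b) \<le> \<beta> * M powr (\<beta> - 1) * (a - b)"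
    using z False assms by (intro mult_left_mono mult_right_mono powr_mono2) auto
  with z False show ?thesis by (simp add: algebra_simps)
qed

lemma nn_integral_powr_Ioo:
  assumes a: "a > (-1::real)" and t: "t \<ge> 0"
  shows "(\<integral>\<^sup>+ s\<in>{0<..<t}. ennreal (s powr a) \<partial>lborel) \<le> ennreal (t powr (a + 1) / (a + 1))"
proof -
  have "(\<integral>\<^sup>+ s\<in>{0<..<t}. ennreal (s powr a) \<partial>lborel) \<le> (\<integral>\<^sup>+ s. ennreal (s powr a) * indicator {0..t} s \<partial>lborel)"
    by (intro nn_integral_mono) (simp add: indicator_def)
  also have "\<dots> = ennreal (t powr (a + 1) / (a + 1))"
    by (rule nn_integral_has_integral_lebesgue'[OF _ has_integral_powr_from_0[OF a t]]) simp
  finally show ?thesis .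
qed

section \<open>The Duhamel term: measurability, monotonicity and limits\<close>

definition duhamel ::
  "real \<Rightarrow> real \<Rightarrow> real \<Rightarrow> real \<Rightarrow> (real \<Rightarrow> 'a::euclidean_space \<Rightarrow> real) \<Rightarrow> real \<Rightarrow> 'a \<Rightarrow> ennreal" where
  "duhamel \<alpha> \<rho> \<sigma> \<beta> w t x = (\<integral>\<^sup>+ s\<in>{0<..<t}. (\<integral>\<^sup>+ y. ennreal (stable_density \<alpha> (t powr \<rho> - s powr \<rho>) (y - x) *
       s powr \<sigma> * w s y powr \<beta>) \<partial>lborel) \<partial>lborel)"

lemma duhamel_0[simp]: "duhamel \<alpha> \<rho> \<sigma> \<beta> w 0 x = 0"
  by (simp add: duhamel_def)

lemma duhamel_cong:
  assumes "\<And>s y. 0 < s \<Longrightarrow> s < t \<Longrightarrow> w s y = w' s y"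
  shows "duhamel \<alpha> \<rho> \<sigma> \<beta> w t x = duhamel \<alpha> \<rho> \<sigma> \<beta> w' t x"
  unfolding duhamel_def using assms by (intro nn_integral_cong) (simp add: indicator_def)

lemma borel_measurable_duhamel:
  assumes "(\<lambda>(t, x). w t x) \<in> borel_measurable (borel :: (real \<times> 'a::euclidean_space) measure)"
  shows "(\<lambda>(t, x). duhamel \<alpha> \<rho> \<sigma> \<beta> w t x) \<in> borel_measurable (borel :: (real \<times> 'a) measure)"
proof -
  have [measurable]: "case_prod w \<in> borel_measurable (borel \<Otimes>\<^sub>M borel)"
    using assms by (simp add: borel_prod)
  \<comment> \<open>Unfolding the indicator of the interval exposes its dependence on
    \<open>t\<close>, as joint measurability in time and space requires.\<close>
  show ?thesis
    unfolding duhamel_def indicator_def greaterThanLessThan_iff borel_prod[symmetric] by measurable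
qed

context
  fixes \<alpha> \<rho> :: real
  assumes \<alpha>: "0 < \<alpha>" "\<alpha> \<le> 2" and \<rho>: "0 < \<rho>" "\<rho> \<le> 1"
begin

lemma stable_density_nonneg_diff:
  assumes "0 < s" "s < t"
  shows "0 \<le> stable_density \<alpha> (t powr \<rho> - s powr \<rho>) x"
  using assms \<rho> by (intro stable_density_nonneg \<alpha>) (simp add: powr_less_mono2)

lemma duhamel_mono:
  assumes "\<And>s y. 0 < s \<Longrightarrow> s < t \<Longrightarrow> 0 \<le> w s y" "\<And>s y. 0 < s \<Longrightarrow> s < t \<Longrightarrow> w s y \<le> w' s y" "0 \<le> \<beta>"
  shows "duhamel \<alpha> \<rho> \<sigma> \<beta> w t x \<le> duhamel \<alpha> \<rho> \<sigma> \<beta> w' t x"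
  unfolding duhamel_def
proof (rule nn_integral_mono)
  fix s
  show "(\<integral>\<^sup>+ y. ennreal (stable_density \<alpha> (t powr \<rho> - s powr \<rho>) (y - x) * s powr \<sigma> * w s y powr \<beta>) \<partial>lborel) * indicator {0<..<t} s
    \<le> (\<integral>\<^sup>+ y. ennreal (stable_density \<alpha> (t powr \<rho> - s powr \<rho>) (y - x) * s powr \<sigma> * w' s y powr \<beta>) \<partial>lborel) * indicator {0<..<t} s"
    (is "?L * _ \<le> ?R * _")
  proof (cases "s \<in> {0<..<t}")
    case True
    then have "?L \<le> ?R"
      using assms by (intro nn_integral_mono ennreal_leI mult_left_mono powr_mono2 mult_nonneg_nonneg stable_density_nonneg_diff) auto
    then show ?thesis by (rule mult_right_mono) simp
  qed simp
qed

text \<open>Monotone convergence, applied to the integral over space and then to the one over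
  time.\<close>

lemma duhamel_LIMSEQ:
  assumes W[measurable]: "\<And>n. (\<lambda>(t, x). W n t x) \<in> borel_measurable (borel :: (real \<times> 'a::euclidean_space) measure)"
    and nonneg: "\<And>n s y. 0 < s \<Longrightarrow> 0 \<le> W n s y"
    and mono: "\<And>s y m n. 0 < s \<Longrightarrow> m \<le> n \<Longrightarrow> W m s y \<le> W n s y"
    and lim: "\<And>s y. 0 < s \<Longrightarrow> (\<lambda>n. W n s y) \<longlonglongrightarrow> w s y"
    and \<beta>: "0 < \<beta>"
  shows "(\<lambda>n. duhamel \<alpha> \<rho> \<sigma> \<beta> (W n) t x) \<longlonglongrightarrow> duhamel \<alpha> \<rho> \<sigma> \<beta> w t x"
proof -
  have [measurable]: "case_prod (W n) \<in> borel_measurable (borel \<Otimes>\<^sub>M borel)" for n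
    using W[of n] by (simp add: borel_prod)
  let ?h = "\<lambda>w s y. ennreal (stable_density \<alpha> (t powr \<rho> - s powr \<rho>) (y - x) * s powr \<sigma> * w s y powr \<beta>)"
  have inner_mono: "?h (W m) s y \<le> ?h (W n) s y" if "m \<le> n" "0 < s" "s < t" for m n s y
    using that mono[of s m n y] nonneg[of s m y] \<beta>
    by (intro ennreal_leI mult_left_mono powr_mono2 mult_nonneg_nonneg stable_density_nonneg_diff) auto
  have inner: "(\<lambda>n. \<integral>\<^sup>+ y. ?h (W n) s y \<partial>lborel) \<longlonglongrightarrow> (\<integral>\<^sup>+ y. ?h w s y \<partial>lborel)" if s: "0 < s" "s < t" for s
  proof (rule nn_integral_LIMSEQ)
    show "incseq (\<lambda>n y. ?h (W n) s y)"
      using inner_mono[OF _ s] by (auto intro!: monoI le_funI)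
    show "(\<lambda>n. ?h (W n) s y) \<longlonglongrightarrow> ?h w s y" for y
      using \<beta> nonneg[OF s(1)] by (intro tendsto_ennrealI tendsto_mult tendsto_const tendsto_powr' lim s) auto
  qed measurable
  show ?thesis unfolding duhamel_def
  proof (rule nn_integral_LIMSEQ)
    show "incseq (\<lambda>n s. (\<integral>\<^sup>+ y. ?h (W n) s y \<partial>lborel) * indicator {0<..<t} s)"
    proof (intro monoI le_funI)
      fix m n :: nat and s assume "m \<le> n"
      then show "(\<integral>\<^sup>+ y. ?h (W m) s y \<partial>lborel) * indicator {0<..<t} s \<le> (\<integral>\<^sup>+ y. ?h (W n) s y \<partial>lborel) * indicator {0<..<t} s"
        by (cases "s \<in> {0<..<t}") (auto intro!: nn_integral_mono inner_mono)
    qed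
    show "(\<lambda>n. (\<integral>\<^sup>+ y. ?h (W n) s y \<partial>lborel) * indicator {0<..<t} s) \<longlonglongrightarrow> (\<integral>\<^sup>+ y. ?h w s y \<partial>lborel) * indicator {0<..<t} s" for s
      by (cases "s \<in> {0<..<t}") (auto intro: inner)
  qed measurable
qed

section \<open>The supersolution profile\<close>

definition profile :: "real \<Rightarrow> real \<Rightarrow> 'a::euclidean_space \<Rightarrow> real" where
  "profile k t x = (1 + t) powr (- k) * (1 + t powr \<rho>) powr (DIM('a) / \<alpha>) * stable_density \<alpha> (1 + t powr \<rho>) x"

lemma one_plus_powr_pos: "0 < 1 + t powr \<rho>"
  by (simp add: add_pos_nonneg)

lemma profile_nonneg: "0 \<le> profile k t x"
  unfolding profile_def using \<alpha> one_plus_powr_pos by (intro mult_nonneg_nonneg stable_density_nonneg) auto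

text \<open>Subadditivity of a concave power: \<open>x \<le> x powr \<rho>\<close> on [0,1], applied
  to two fractions whose sum is 1. This is where \<open>\<rho> \<le> 1\<close> enters.\<close>

lemma one_plus_powr_le:
  assumes "0 \<le> t"
  shows "(1 + t) powr \<rho> \<le> 1 + t powr \<rho>"
proof -
  have t1: "1 + t > 0" using assms by simp
  have frac: "x \<le> x powr \<rho>" if "0 \<le> x" "x \<le> 1" for x :: real
    using powr_mono'[of \<rho> 1 x] that \<rho> by simp
  have "1 = 1 / (1 + t) + t / (1 + t)" using t1 by (simp add: add_divide_distrib[symmetric])
  also have "\<dots> \<le> (1 / (1 + t)) powr \<rho> + (t / (1 + t)) powr \<rho>"
    using assms by (intro add_mono frac) auto
  also have "\<dots> = (1 + t powr \<rho>) / (1 + t) powr \<rho>"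
    using assms by (simp add: powr_divide add_divide_distrib)
  finally show ?thesis using t1 by (simp add: field_simps)
qed

text \<open>By the convolution identity, the density on the left is the linear evolution of the
  initial datum \<open>stable_density \<alpha> 1\<close>. It lies below the profile because
  \<open>(1 + t) powr k\<close> grows no faster than the weight when \<open>k\<close> is at most
  d\<rho>/\<alpha>.\<close>

lemma stable_density_le_profile:
  fixes x :: "'a::euclidean_space"
  assumes t: "0 \<le> t" and k: "k \<le> DIM('a) * \<rho> / \<alpha>"
  shows "stable_density \<alpha> (1 + t powr \<rho>) x \<le> profile k t x"
proof -
  have "(1 + t) powr k \<le> (1 + t) powr (\<rho> * (DIM('a) / \<alpha>))"
    using t k by (intro powr_mono) (auto simp: ac_simps)
  also have "\<dots> = ((1 + t) powr \<rho>) powr (DIM('a) / \<alpha>)" by (simp add: powr_powr)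
  also have "\<dots> \<le> (1 + t powr \<rho>) powr (DIM('a) / \<alpha>)"
    using one_plus_powr_le[OF t] \<alpha> by (intro powr_mono2) auto
  finally have "1 \<le> (1 + t) powr (- k) * (1 + t powr \<rho>) powr (DIM('a) / \<alpha>)"
    using t by (simp add: powr_minus field_simps)
  from mult_right_mono[OF this, of "stable_density \<alpha> (1 + t powr \<rho>) x"] show ?thesis
    using stable_density_nonneg[OF \<alpha> one_plus_powr_pos[of t], of x] by (simp add: profile_def)
qed

text \<open>By scaling, the weight times the density never exceeds the value at time 1 and the
  origin; the decay of the profile sits in \<open>(1 + t) powr (- k)\<close> alone.\<close>

lemma profile_le:
  fixes x :: "'a::euclidean_space"
  assumes "0 \<le> t" "0 \<le> k"
  shows "profile k t x \<le> stable_density \<alpha> 1 (0::'a)"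
proof -
  have "(1 + t) powr (- k) \<le> 1" using assms powr_mono[of "- k" 0 "1 + t"] by simp
  then have "(1 + t) powr (- k) * ((1 + t powr \<rho>) powr (DIM('a) / \<alpha>) * stable_density \<alpha> (1 + t powr \<rho>) x)
     \<le> 1 * stable_density \<alpha> 1 (0::'a)"
    using stable_density_nonneg[OF \<alpha> one_plus_powr_pos[of t], of x]
    by (intro mult_mono stable_density_le[OF \<alpha> one_plus_powr_pos]) auto
  then show ?thesis by (simp add: profile_def ac_simps)
qed

text \<open>Bounding all but one power of weight times density by \<open>m\<close> leaves a single
  density on which the convolution identity acts. The relation between \<open>k\<close> and
  \<open>k'\<close> turns the powers of \<open>1 + s\<close> into
  \<open>\<delta> - \<sigma> - 1\<close>, so the time integral is of order
  \<open>(1 + t) powr \<delta>\<close>. Since \<open>\<delta> + k'\<close> is d\<rho>/\<alpha>, this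
  is at most \<open>(1 + t) powr (- k')\<close> times the weight.\<close>

lemma duhamel_profile_le:
  fixes w :: "real \<Rightarrow> 'a::euclidean_space \<Rightarrow> real" and x :: 'a
  assumes w: "\<And>s y. 0 < s \<Longrightarrow> 0 \<le> w s y" "\<And>s y. 0 < s \<Longrightarrow> w s y \<le> B * profile k s y"
    and B: "0 \<le> B" and \<beta>: "1 < \<beta>" and \<sigma>: "\<sigma> > -1"
    and k: "k * \<beta> = k' + 1 + \<sigma>" and k': "k' < DIM('a) * \<rho> / \<alpha>" and t: "0 < t"
  shows "duhamel \<alpha> \<rho> \<sigma> \<beta> w t x \<le> ennreal (B powr \<beta> * (stable_density \<alpha> 1 (0::'a) powr (\<beta> - 1) *
     2 powr (DIM('a) / \<alpha>) / min (\<sigma> + 1) (DIM('a) * \<rho> / \<alpha> - k')) * profile k' t x)"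
proof -
  let ?p = "stable_density \<alpha> :: real \<Rightarrow> 'a \<Rightarrow> real"
  define D where "D = DIM('a) * \<rho> / \<alpha>"
  define m where "m = ?p 1 0"
  \<comment> \<open>The gap to the critical exponent; its positivity is what the integral over time
    needs.\<close>
  define \<delta> where "\<delta> = D - k'"
  define A where "A = B powr \<beta> * (m powr (\<beta> - 1) * 2 powr (DIM('a) / \<alpha>))"
  have \<delta>: "\<delta> > 0" using k' by (simp add: \<delta>_def D_def)
  have A: "A \<ge> 0" by (simp add: A_def)
  have pos: "0 \<le> ?p (1 + s powr \<rho>) y" for s y
    using \<alpha> one_plus_powr_pos by (rule stable_density_nonneg)
  have point: "w s y powr \<beta> \<le> A * (1 + s) powr (\<delta> - \<sigma> - 1) * ?p (1 + s powr \<rho>) y" if s: "0 < s" for s y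
  proof -
    define q where "q = (1 + s powr \<rho>) powr (DIM('a) / \<alpha>) * ?p (1 + s powr \<rho>) y"
    have q: "0 \<le> q" "q \<le> m"
      unfolding q_def m_def using pos stable_density_le[OF \<alpha> one_plus_powr_pos] by auto
    have "w s y powr \<beta> \<le> (B * (1 + s) powr (- k) * q) powr \<beta>"
      using w[OF s] \<beta> by (intro powr_mono2) (auto simp: profile_def q_def ac_simps)
    also have "\<dots> = B powr \<beta> * (1 + s) powr (- (k * \<beta>)) * q powr \<beta>"
      using B q s by (simp add: powr_mult powr_powr)
    also have "q powr \<beta> = q powr (\<beta> - 1) * q"
      using q(1) powr_add[of q "\<beta> - 1" 1] by (cases "q = 0") auto
    also have "B powr \<beta> * (1 + s) powr (- (k * \<beta>)) * (q powr (\<beta> - 1) * q) \<le>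
        B powr \<beta> * (1 + s) powr (- (k * \<beta>)) * (m powr (\<beta> - 1) * q)"
      using q \<beta> by (intro mult_left_mono mult_right_mono powr_mono2) auto
    \<comment> \<open>The converse of \<open>one_plus_powr_le\<close>, up to the constant
      \<open>2 powr (DIM('a) / \<alpha>)\<close>.\<close>
    also have "q \<le> 2 powr (DIM('a) / \<alpha>) * (1 + s) powr D * ?p (1 + s powr \<rho>) y"
      unfolding q_def
    proof (rule mult_right_mono[OF _ pos])
      have "1 \<le> (1 + s) powr \<rho>" using s \<rho> by (intro ge_one_powr_ge_zero) auto
      moreover have "s powr \<rho> \<le> (1 + s) powr \<rho>" using s \<rho> by (intro powr_mono2) auto
      ultimately have "(1 + s powr \<rho>) powr (DIM('a) / \<alpha>) \<le> (2 * (1 + s) powr \<rho>) powr (DIM('a) / \<alpha>)"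
        using \<alpha> one_plus_powr_pos[of s] by (intro powr_mono2) auto
      also have "\<dots> = 2 powr (DIM('a) / \<alpha>) * (1 + s) powr D"
        using s by (simp add: powr_mult powr_powr D_def ac_simps)
      finally show "(1 + s powr \<rho>) powr (DIM('a) / \<alpha>) \<le> 2 powr (DIM('a) / \<alpha>) * (1 + s) powr D" .
    qed
    then have "B powr \<beta> * (1 + s) powr (- (k * \<beta>)) * (m powr (\<beta> - 1) * q) \<le>
       B powr \<beta> * (1 + s) powr (- (k * \<beta>)) * (m powr (\<beta> - 1) * (2 powr (DIM('a) / \<alpha>) * (1 + s) powr D * ?p (1 + s powr \<rho>) y))"
      by (intro mult_left_mono) auto
    also have "\<dots> = A * ((1 + s) powr (- (k * \<beta>)) * (1 + s) powr D) * ?p (1 + s powr \<rho>) y"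
      by (simp add: A_def ac_simps)
    also have "(1 + s) powr (- (k * \<beta>)) * (1 + s) powr D = (1 + s) powr (\<delta> - \<sigma> - 1)"
      unfolding k powr_add[symmetric] by (simp add: \<delta>_def algebra_simps)
    finally show ?thesis .
  qed
  define P where "P = ?p (1 + t powr \<rho>) x"
  have P: "P \<ge> 0" unfolding P_def by (rule pos)
  have inner: "(\<integral>\<^sup>+ y. ennreal (?p (t powr \<rho> - s powr \<rho>) (y - x) * s powr \<sigma> * w s y powr \<beta>) \<partial>lborel)
      \<le> ennreal (A * P) * ennreal (s powr \<sigma> * (1 + s) powr (\<delta> - \<sigma> - 1))" if s: "0 < s" "s < t" for s
  proof -
    let ?c = "s powr \<sigma> * (A * (1 + s) powr (\<delta> - \<sigma> - 1))"
    have c: "0 \<le> ?c" using A by simp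
    have "(\<integral>\<^sup>+ y. ennreal (?p (t powr \<rho> - s powr \<rho>) (y - x) * s powr \<sigma> * w s y powr \<beta>) \<partial>lborel)
      \<le> (\<integral>\<^sup>+ y. ennreal ?c * ennreal (?p (t powr \<rho> - s powr \<rho>) (y - x) * ?p (1 + s powr \<rho>) y) \<partial>lborel)"
    proof (rule nn_integral_mono)
      fix y
      have pp: "0 \<le> ?p (t powr \<rho> - s powr \<rho>) (y - x)" by (rule stable_density_nonneg_diff[OF s])
      have "?p (t powr \<rho> - s powr \<rho>) (y - x) * s powr \<sigma> * w s y powr \<beta>
         \<le> ?p (t powr \<rho> - s powr \<rho>) (y - x) * s powr \<sigma> * (A * (1 + s) powr (\<delta> - \<sigma> - 1) * ?p (1 + s powr \<rho>) y)"
        by (intro mult_left_mono point s mult_nonneg_nonneg pp) simp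
      also have "\<dots> = ?c * (?p (t powr \<rho> - s powr \<rho>) (y - x) * ?p (1 + s powr \<rho>) y)"
        by (simp add: ac_simps)
      finally show "ennreal (?p (t powr \<rho> - s powr \<rho>) (y - x) * s powr \<sigma> * w s y powr \<beta>)
        \<le> ennreal ?c * ennreal (?p (t powr \<rho> - s powr \<rho>) (y - x) * ?p (1 + s powr \<rho>) y)"
        using pp pos c by (simp add: ennreal_mult[symmetric] ennreal_leI)
    qed
    also have "\<dots> = ennreal ?c * (\<integral>\<^sup>+ y. ennreal (?p (t powr \<rho> - s powr \<rho>) (y - x) * ?p (1 + s powr \<rho>) y) \<partial>lborel)"
      by (rule nn_integral_cmult) measurable
    also have "\<dots> = ennreal ?c * ennreal (?p ((t powr \<rho> - s powr \<rho>) + (1 + s powr \<rho>)) x)"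
      using s \<rho> one_plus_powr_pos by (subst stable_density_convolution[OF \<alpha>]) (auto simp: powr_less_mono2)
    \<comment> \<open>The two kernel times add up to a value independent of \<open>s\<close>, so the
      density leaves the time integral.\<close>
    also have "(t powr \<rho> - s powr \<rho>) + (1 + s powr \<rho>) = 1 + t powr \<rho>" by simp
    also have "ennreal ?c * ennreal (?p (1 + t powr \<rho>) x) = ennreal (A * P) * ennreal (s powr \<sigma> * (1 + s) powr (\<delta> - \<sigma> - 1))"
      using A P pos by (simp add: P_def ennreal_mult[symmetric] ac_simps)
    finally show ?thesis .
  qed
  have "duhamel \<alpha> \<rho> \<sigma> \<beta> w t x \<le> (\<integral>\<^sup>+ s. ennreal (A * P) * (ennreal (s powr \<sigma> * (1 + s) powr (\<delta> - \<sigma> - 1)) * indicator {0<..<t} s) \<partial>lborel)"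
    unfolding duhamel_def
  proof (rule nn_integral_mono)
    fix s
    show "(\<integral>\<^sup>+ y. ennreal (?p (t powr \<rho> - s powr \<rho>) (y - x) * s powr \<sigma> * w s y powr \<beta>) \<partial>lborel) * indicator {0<..<t} s
       \<le> ennreal (A * P) * (ennreal (s powr \<sigma> * (1 + s) powr (\<delta> - \<sigma> - 1)) * indicator {0<..<t} s)"
      using inner[of s] by (cases "s \<in> {0<..<t}") auto
  qed
  also have "\<dots> = ennreal (A * P) * (\<integral>\<^sup>+ s\<in>{0<..<t}. ennreal (s powr \<sigma> * (1 + s) powr (\<delta> - \<sigma> - 1)) \<partial>lborel)"
    by (rule nn_integral_cmult) measurable
  also have "\<dots> \<le> ennreal (A * P) * ennreal ((1 + t) powr \<delta> / min (\<sigma> + 1) \<delta>)"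
    by (intro mult_left_mono nn_integral_weight_le \<sigma> \<delta> t) simp
  also have "\<dots> = ennreal (A / min (\<sigma> + 1) \<delta> * ((1 + t) powr \<delta> * P))"
    using A P by (simp add: ennreal_mult'[symmetric] ac_simps)
  also have "\<dots> \<le> ennreal (A / min (\<sigma> + 1) \<delta> * profile k' t x)"
  proof (intro ennreal_leI mult_left_mono)
    have "(1 + t) powr \<delta> = (1 + t) powr (- k') * ((1 + t) powr \<rho>) powr (DIM('a) / \<alpha>)"
      by (simp add: powr_powr powr_add[symmetric] \<delta>_def D_def ac_simps)
    also have "\<dots> \<le> (1 + t) powr (- k') * (1 + t powr \<rho>) powr (DIM('a) / \<alpha>)"
      using one_plus_powr_le[of t] t \<alpha> by (intro mult_left_mono powr_mono2) auto
    finally have "(1 + t) powr \<delta> * P \<le> (1 + t) powr (- k') * (1 + t powr \<rho>) powr (DIM('a) / \<alpha>) * P"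
      by (rule mult_right_mono[OF _ P])
    then show "(1 + t) powr \<delta> * P \<le> profile k' t x"
      by (simp add: profile_def P_def)
    show "0 \<le> A / min (\<sigma> + 1) \<delta>" using A \<sigma> \<delta> by simp
  qed
  finally show ?thesis by (simp add: A_def m_def \<delta>_def D_def mult.assoc)
qed

end

section \<open>Uniqueness and existence of mild solutions\<close>

context
  fixes \<alpha> \<rho> :: real
  assumes \<alpha>: "0 < \<alpha>" "\<alpha> \<le> 2" and \<rho>: "0 < \<rho>" "\<rho> \<le> 1"
begin

text \<open>The gap \<open>g\<close> depends on time only, so the spatial integral of the error is
  controlled by the kernel mass, at most 1. Measurability is asked of \<open>w'\<close> because its
  term is the one separated from a sum of integrals.\<close>

lemma duhamel_diff_le:
  fixes w w' :: "real \<Rightarrow> 'a::euclidean_space \<Rightarrow> real"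
  assumes w: "\<And>s y. 0 < s \<Longrightarrow> s < t \<Longrightarrow> 0 \<le> w s y \<and> w s y \<le> M"
    and w': "\<And>s y. 0 < s \<Longrightarrow> s < t \<Longrightarrow> 0 \<le> w' s y \<and> w' s y \<le> M"
    and meas: "(\<lambda>(t, x). w' t x) \<in> borel_measurable borel"
    and g: "g \<in> borel_measurable borel" "\<And>s y. 0 < s \<Longrightarrow> s < t \<Longrightarrow> \<bar>w s y - w' s y\<bar> \<le> g s"
    and \<beta>: "1 < \<beta>"
  shows "duhamel \<alpha> \<rho> \<sigma> \<beta> w t x \<le> duhamel \<alpha> \<rho> \<sigma> \<beta> w' t x +
           (\<integral>\<^sup>+ s\<in>{0<..<t}. ennreal (s powr \<sigma> * (\<beta> * M powr (\<beta> - 1)) * g s) \<partial>lborel)"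
proof -
  note [measurable] = g(1)
  have [measurable]: "case_prod w' \<in> borel_measurable (borel \<Otimes>\<^sub>M borel)"
    using meas by (simp add: borel_prod)
  let ?h = "\<lambda>w s y. ennreal (stable_density \<alpha> (t powr \<rho> - s powr \<rho>) (y - x) * s powr \<sigma> * w s y powr \<beta>)"
  define L where "L = \<beta> * M powr (\<beta> - 1)"
  have L: "0 \<le> L" using \<beta> by (simp add: L_def)
  let ?e = "\<lambda>s. s powr \<sigma> * L * g s"
  have inner: "(\<integral>\<^sup>+ y. ?h w s y \<partial>lborel) \<le> (\<integral>\<^sup>+ y. ?h w' s y \<partial>lborel) + ennreal (?e s)" if s: "0 < s" "s < t" for s
  proof -
    let ?p = "\<lambda>y. stable_density \<alpha> (t powr \<rho> - s powr \<rho>) (y - x)"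
    have p: "0 \<le> ?p y" for y using s by (rule stable_density_nonneg_diff[OF \<alpha> \<rho>])
    have gs: "0 \<le> g s" using g(2)[OF s, of 0] by linarith
    have "?h w s y \<le> ?h w' s y + ennreal (?e s) * ennreal (?p y)" for y
    proof -
      have "w s y powr \<beta> \<le> w' s y powr \<beta> + L * \<bar>w s y - w' s y\<bar>"
        unfolding L_def using w[OF s, of y] w'[OF s, of y] \<beta> by (intro powr_diff_le) auto
      also have "\<dots> \<le> w' s y powr \<beta> + L * g s"
        using g(2)[OF s] L by (intro add_left_mono mult_left_mono) auto
      finally have "?p y * s powr \<sigma> * w s y powr \<beta> \<le> ?p y * s powr \<sigma> * (w' s y powr \<beta> + L * g s)"
        using p by (intro mult_left_mono) auto
      then have "?h w s y \<le> ennreal (?p y * s powr \<sigma> * w' s y powr \<beta> + ?e s * ?p y)"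
        by (intro ennreal_leI) (simp add: algebra_simps)
      also have "\<dots> = ?h w' s y + ennreal (?e s) * ennreal (?p y)"
        using p L gs by (simp add: ennreal_plus ennreal_mult)
      finally show ?thesis .
    qed
    then have "(\<integral>\<^sup>+ y. ?h w s y \<partial>lborel) \<le> (\<integral>\<^sup>+ y. ?h w' s y + ennreal (?e s) * ennreal (?p y) \<partial>lborel)"
      by (rule nn_integral_mono)
    also have "\<dots> = (\<integral>\<^sup>+ y. ?h w' s y \<partial>lborel) + ennreal (?e s) * (\<integral>\<^sup>+ y. ennreal (?p y) \<partial>lborel)"
      by (simp add: nn_integral_add nn_integral_cmult)
    also have "\<dots> \<le> (\<integral>\<^sup>+ y. ?h w' s y \<partial>lborel) + ennreal (?e s) * 1"
      using s \<rho> by (intro add_left_mono mult_left_mono nn_integral_stable_density_translate_le_1[OF \<alpha>]) (auto simp: powr_less_mono2)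
    finally show ?thesis by simp
  qed
  have "duhamel \<alpha> \<rho> \<sigma> \<beta> w t x \<le> (\<integral>\<^sup>+ s. (\<integral>\<^sup>+ y. ?h w' s y \<partial>lborel) * indicator {0<..<t} s + ennreal (?e s) * indicator {0<..<t} s \<partial>lborel)"
    unfolding duhamel_def
  proof (rule nn_integral_mono)
    fix s
    show "(\<integral>\<^sup>+ y. ?h w s y \<partial>lborel) * indicator {0<..<t} s \<le>
      (\<integral>\<^sup>+ y. ?h w' s y \<partial>lborel) * indicator {0<..<t} s + ennreal (?e s) * indicator {0<..<t} s"
      using inner[of s] by (cases "s \<in> {0<..<t}") auto
  qed
  also have "\<dots> = duhamel \<alpha> \<rho> \<sigma> \<beta> w' t x + (\<integral>\<^sup>+ s\<in>{0<..<t}. ennreal (?e s) \<partial>lborel)"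
    unfolding duhamel_def by (rule nn_integral_add) measurable
  finally show ?thesis unfolding L_def .
qed

lemma mild_solution_duhamel:
  assumes "mild_solution \<alpha> \<rho> \<beta> \<sigma> \<phi> u" "i \<in> {1,2}" "0 < t"
  shows "ennreal (u i t x) = (\<integral>\<^sup>+ y. ennreal (stable_density \<alpha> (t powr \<rho>) (y - x) * \<phi> i y) \<partial>lborel)
          + duhamel \<alpha> \<rho> (\<sigma> i) (\<beta> i) (u (3 - i)) t x"
  using assms unfolding mild_solution_def duhamel_def by blast

lemma
  assumes "mild_solution \<alpha> \<rho> \<beta> \<sigma> \<phi> u" "i \<in> {1,2}"
  shows mild_solution_initial: "u i 0 x = \<phi> i x"
    and mild_solution_nonneg: "0 \<le> t \<Longrightarrow> 0 \<le> u i t x"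
    and mild_solution_measurable: "set_borel_measurable borel ({0..} \<times> UNIV) (\<lambda>(t, x). u i t x)"
    and mild_solution_bounded: "\<exists>M. \<forall>t\<in>{0..T}. \<forall>x. u i t x \<le> M"
  using bspec[OF assms(1)[unfolded mild_solution_def] assms(2)] by simp_all

text \<open>Each pass through the equation turns the bound \<open>A n\<close> for the difference of
  two solutions into \<open>A (Suc n)\<close>. The singularity of the time weight at 0 is
  integrable, so every pass gains a power \<open>q > 0\<close> of \<open>t\<close> and a factor of
  order 1/n.\<close>

lemma mild_solution_unique:
  fixes u v :: "nat \<Rightarrow> real \<Rightarrow> 'a::euclidean_space \<Rightarrow> real"
  assumes u: "mild_solution \<alpha> \<rho> \<beta> \<sigma> \<phi> u" and v: "mild_solution \<alpha> \<rho> \<beta> \<sigma> \<phi> v"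
    and \<beta>: "\<And>i. i \<in> {1,2} \<Longrightarrow> 1 < \<beta> i" and \<sigma>: "\<And>i. i \<in> {1,2} \<Longrightarrow> -1 < \<sigma> i"
    and i: "i \<in> {1,2}" and T: "0 \<le> T"
  shows "u i T x = v i T x"
proof (cases "T = 0")
  case True
  then show ?thesis using mild_solution_initial[OF u i] mild_solution_initial[OF v i] by simp
next
  case False
  with T have T: "0 < T" by simp
  have 3: "3 - j \<in> {1,2}" if "j \<in> {1,2}" for j :: nat using that by auto
  obtain M where M: "\<And>j t x. j \<in> {1,2} \<Longrightarrow> t \<in> {0..T} \<Longrightarrow> u j t x \<le> M \<and> v j t x \<le> M"
  proof -
    from mild_solution_bounded[OF u, of 1 T] mild_solution_bounded[OF u, of 2 T]
      mild_solution_bounded[OF v, of 1 T] mild_solution_bounded[OF v, of 2 T] obtain B1 B2 B3 B4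
      where "\<forall>t\<in>{0..T}. \<forall>x. u 1 t x \<le> B1" "\<forall>t\<in>{0..T}. \<forall>x. u 2 t x \<le> B2"
        "\<forall>t\<in>{0..T}. \<forall>x. v 1 t x \<le> B3" "\<forall>t\<in>{0..T}. \<forall>x. v 2 t x \<le> B4" by auto
    then show thesis by (intro that[of "max (max B1 B2) (max B3 B4)"]) (auto simp: le_max_iff_disj)
  qed
  have nonneg: "0 \<le> u j t x" "0 \<le> v j t x" if "j \<in> {1,2}" "0 \<le> t" for j t x
    using mild_solution_nonneg[OF u that] mild_solution_nonneg[OF v that] by auto
  have M0: "0 \<le> M" using nonneg(1)[OF i order_refl, of 0] M[OF i, of 0] T by (auto intro: order_trans)
  \<comment> \<open>The more singular of the two exponents; on (0,T] both weights are then at most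
    \<open>C * s powr \<kappa>\<close>, Lipschitz constants included.\<close>
  define \<kappa> where "\<kappa> = min (\<sigma> 1) (\<sigma> 2)"
  define q where "q = \<kappa> + 1"
  have q: "0 < q" using \<sigma>[of 1] \<sigma>[of 2] by (simp add: q_def \<kappa>_def)
  define L where "L = (\<lambda>j. \<beta> j * M powr (\<beta> j - 1))"
  define C where "C = T powr (\<sigma> 1 - \<kappa>) * L 1 + T powr (\<sigma> 2 - \<kappa>) * L 2"
  have L: "0 \<le> L j" if "j \<in> {1,2}" for j using \<beta>[OF that] by (simp add: L_def)
  have C0: "0 \<le> C" using L[of 1] L[of 2] by (simp add: C_def)
  have C: "s powr \<sigma> j * L j \<le> C * s powr \<kappa>" if j: "j \<in> {1,2}" and s: "0 < s" "s \<le> T" for j s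
  proof -
    have "\<kappa> \<le> \<sigma> j" using j by (auto simp: \<kappa>_def)
    then have "s powr (\<sigma> j - \<kappa>) \<le> T powr (\<sigma> j - \<kappa>)" using s by (intro powr_mono2) auto
    then have "s powr (\<sigma> j - \<kappa>) * L j \<le> T powr (\<sigma> j - \<kappa>) * L j"
      by (rule mult_right_mono[OF _ L[OF j]])
    also have "\<dots> \<le> C" using j L[of 1] L[of 2] by (auto simp: C_def)
    finally have "s powr \<kappa> * (s powr (\<sigma> j - \<kappa>) * L j) \<le> s powr \<kappa> * C" by (rule mult_left_mono) simp
    moreover have "s powr \<sigma> j = s powr \<kappa> * s powr (\<sigma> j - \<kappa>)" by (simp add: powr_add[symmetric])
    ultimately show ?thesis by (simp add: ac_simps)
  qed
  \<comment> \<open>Integrating \<open>C * s powr \<kappa>\<close> against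
    \<open>s powr (real n * q)\<close> yields
    \<open>C * t powr (real (Suc n) * q) / (real (Suc n) * q)\<close>; iteration gives
    \<open>(C / q) ^ n / fact n\<close>. Since \<open>0 powr 0 = 0\<close>, the starting bound
    \<open>A 0 t = M\<close> holds only for \<open>t > 0\<close>.\<close>
  define A where "A = (\<lambda>n t. M * (C / q) ^ n / fact n * t powr (real n * q))"
  have A_int: "(\<integral>\<^sup>+ s\<in>{0<..<t}. ennreal (s powr \<sigma> j * L j * A n s) \<partial>lborel) \<le> ennreal (A (Suc n) t)"
    if j: "j \<in> {1,2}" and t: "0 < t" "t \<le> T" for j n t
  proof -
    let ?c = "C * (M * (C / q) ^ n / fact n)"
    have c: "0 \<le> ?c" using C0 M0 q by simp
    have "(\<integral>\<^sup>+ s\<in>{0<..<t}. ennreal (s powr \<sigma> j * L j * A n s) \<partial>lborel)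
      \<le> (\<integral>\<^sup>+ s. ennreal ?c * (ennreal (s powr (\<kappa> + real n * q)) * indicator {0<..<t} s) \<partial>lborel)"
    proof (rule nn_integral_mono)
      fix s
      show "ennreal (s powr \<sigma> j * L j * A n s) * indicator {0<..<t} s
        \<le> ennreal ?c * (ennreal (s powr (\<kappa> + real n * q)) * indicator {0<..<t} s)"
      proof (cases "s \<in> {0<..<t}")
        case True
        have "s powr \<sigma> j * L j * A n s \<le> C * s powr \<kappa> * A n s"
          using True t C0 M0 q by (intro mult_right_mono C j) (auto simp: A_def)
        also have "\<dots> = ?c * s powr (\<kappa> + real n * q)" by (simp add: A_def powr_add)
        finally show ?thesis using True c by (simp add: ennreal_mult'[symmetric] ennreal_leI)
      qed simp
    qed
    also have "\<dots> = ennreal ?c * (\<integral>\<^sup>+ s\<in>{0<..<t}. ennreal (s powr (\<kappa> + real n * q)) \<partial>lborel)"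
      by (rule nn_integral_cmult) measurable
    also have "\<dots> \<le> ennreal ?c * ennreal (t powr (\<kappa> + real n * q + 1) / (\<kappa> + real n * q + 1))"
    proof (intro mult_left_mono nn_integral_powr_Ioo)
      have "0 \<le> real n * q" using q by simp
      moreover have "-1 < \<kappa>" using q by (simp add: q_def)
      ultimately show "-1 < \<kappa> + real n * q" by linarith
    qed (use t in auto)
    also have "\<kappa> + real n * q + 1 = real (Suc n) * q" by (simp add: q_def algebra_simps)
    also have "ennreal ?c * ennreal (t powr (real (Suc n) * q) / (real (Suc n) * q)) = ennreal (A (Suc n) t)"
      using c q unfolding ennreal_mult'[OF c, symmetric] by (simp add: A_def field_simps)
    finally show ?thesis .
  qed
  have step: "w j t x \<le> w' j t x + A (Suc n) t"
    if w: "mild_solution \<alpha> \<rho> \<beta> \<sigma> \<phi> w" and w': "mild_solution \<alpha> \<rho> \<beta> \<sigma> \<phi> w'"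
      and wM: "\<And>j t x. j \<in> {1,2} \<Longrightarrow> t \<in> {0..T} \<Longrightarrow> w j t x \<le> M \<and> w' j t x \<le> M"
      and wd: "\<And>j t x. j \<in> {1,2} \<Longrightarrow> 0 < t \<Longrightarrow> t \<le> T \<Longrightarrow> \<bar>w j t x - w' j t x\<bar> \<le> A n t"
      and j: "j \<in> {1,2}" and t: "0 < t" "t \<le> T" for w w' j t x n
  proof -
    have nn: "0 \<le> w j t x" "0 \<le> w' j t x" if "j \<in> {1,2}" "0 \<le> t" for j t x
      using mild_solution_nonneg[OF w that] mild_solution_nonneg[OF w' that] by auto
    \<comment> \<open>Solutions are measurable only on non-negative times. Extension by 0 is
      globally measurable and leaves the Duhamel term unchanged.\<close>
    let ?z = "\<lambda>t x. if 0 \<le> t then w' (3 - j) t x else 0"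
    have "set_borel_measurable borel ({0..} \<times> UNIV) (\<lambda>(t, x). w' (3 - j) t x)"
      by (rule mild_solution_measurable[OF w' 3[OF j]])
    then have zm: "(\<lambda>(t, x). ?z t x) \<in> borel_measurable borel"
      unfolding set_borel_measurable_def
      by (rule measurable_cong[THEN iffD1, rotated]) (auto simp: indicator_def split: if_splits)
    have "duhamel \<alpha> \<rho> (\<sigma> j) (\<beta> j) (w (3 - j)) t x \<le> duhamel \<alpha> \<rho> (\<sigma> j) (\<beta> j) ?z t x +
           (\<integral>\<^sup>+ s\<in>{0<..<t}. ennreal (s powr \<sigma> j * (\<beta> j * M powr (\<beta> j - 1)) * A n s) \<partial>lborel)"
    proof (rule duhamel_diff_le[OF _ _ zm])
      show "A n \<in> borel_measurable borel" unfolding A_def by measurable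
    qed (use t nn[OF 3[OF j]] wM[OF 3[OF j]] wd[OF 3[OF j]] \<beta>[OF j] in auto)
    also have "duhamel \<alpha> \<rho> (\<sigma> j) (\<beta> j) ?z t x = duhamel \<alpha> \<rho> (\<sigma> j) (\<beta> j) (w' (3 - j)) t x"
      by (rule duhamel_cong) simp
    also have "(\<integral>\<^sup>+ s\<in>{0<..<t}. ennreal (s powr \<sigma> j * (\<beta> j * M powr (\<beta> j - 1)) * A n s) \<partial>lborel) \<le> ennreal (A (Suc n) t)"
      using A_int[OF j t, of n] unfolding L_def .
    finally have "ennreal (w j t x) \<le> ennreal (w' j t x) + ennreal (A (Suc n) t)"
      unfolding mild_solution_duhamel[OF w j t(1)] mild_solution_duhamel[OF w' j t(1)]
      by (simp add: add.assoc add_left_mono)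
    also have "\<dots> = ennreal (w' j t x + A (Suc n) t)"
      using nn(2)[OF j, of t x] t M0 C0 q by (subst ennreal_plus) (auto simp: A_def)
    finally show ?thesis
      using nn(2)[OF j, of t x] t M0 C0 q by (subst (asm) ennreal_le_iff) (auto simp: A_def)
  qed
  have bound: "\<bar>u j t x - v j t x\<bar> \<le> A n t" if "j \<in> {1,2}" "0 < t" "t \<le> T" for n j t x
    using that
  proof (induction n arbitrary: j t x)
    case 0
    then show ?case using nonneg[of j t x] M[of j t x] by (simp add: A_def abs_le_iff)
  next
    case (Suc n)
    have "u j t x \<le> v j t x + A (Suc n) t"
      by (rule step[OF u v M Suc.IH Suc.prems])
    moreover have "v j t x \<le> u j t x + A (Suc n) t"
      by (rule step[OF v u _ _ Suc.prems]) (use M Suc.IH in \<open>auto simp: abs_minus_commute\<close>)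
    ultimately show ?case by linarith
  qed
  \<comment> \<open>\<open>A n T\<close> is \<open>M\<close> times a term of a convergent
    exponential series.\<close>
  have "(\<lambda>n. M * (inverse (fact n) * (C / q * T powr q) ^ n)) \<longlonglongrightarrow> M * 0"
    by (intro tendsto_mult tendsto_const summable_LIMSEQ_zero summable_exp)
  moreover have "M * (inverse (fact n) * (C / q * T powr q) ^ n) = A n T" for n
  proof -
    have "(T powr q) ^ n = T powr (real n * q)"
      using T by (simp add: powr_realpow[symmetric] powr_powr mult.commute)
    then show ?thesis by (simp add: A_def power_mult_distrib divide_inverse ac_simps)
  qed
  ultimately have "(\<lambda>n. A n T) \<longlonglongrightarrow> 0" by simp
  then have "\<bar>u i T x - v i T x\<bar> \<le> 0"
    by (rule LIMSEQ_le_const) (use bound[OF i T order_refl] in blast)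
  then show ?thesis by simp
qed

text \<open>The assumption \<open>small\<close> says that the Duhamel term of the barrier
  \<open>2 * S\<close> is at most \<open>S\<close>; as the linear part \<open>a\<close> is also at
  most \<open>S\<close>, the iterates never leave the barrier. The barrier yields both the decay and
  the boundedness required of a mild solution.\<close>

lemma mild_solution_exists:
  fixes \<phi> :: "nat \<Rightarrow> 'a::euclidean_space \<Rightarrow> real"
  assumes \<beta>: "\<And>i. i \<in> {1,2} \<Longrightarrow> 1 < \<beta> i" and \<sigma>: "\<And>i. i \<in> {1,2} \<Longrightarrow> -1 < \<sigma> i"
    and k: "\<And>i. i \<in> {1,2} \<Longrightarrow> 0 < k i" "\<And>i. i \<in> {1,2} \<Longrightarrow> k i < DIM('a) * \<rho> / \<alpha>"
      "\<And>i. i \<in> {1,2} \<Longrightarrow> k (3 - i) * \<beta> i = k i + 1 + \<sigma> i"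
    and \<epsilon>: "0 < \<epsilon>"
    and small: "\<And>i. i \<in> {1,2} \<Longrightarrow> (2 * \<epsilon>) powr \<beta> i * (stable_density \<alpha> 1 (0::'a) powr (\<beta> i - 1) *
       2 powr (DIM('a) / \<alpha>) / min (\<sigma> i + 1) (DIM('a) * \<rho> / \<alpha> - k i)) \<le> \<epsilon>"
    and \<phi>: "\<And>i x. i \<in> {1,2} \<Longrightarrow> \<phi> i x = \<epsilon> * stable_density \<alpha> 1 x"
  shows "\<exists>u. mild_solution \<alpha> \<rho> \<beta> \<sigma> \<phi> u \<and> (\<forall>i\<in>{1,2}. \<forall>t\<ge>0. \<forall>x. u i t x \<le> 2 * \<epsilon> * profile \<alpha> \<rho> (k i) t x)"
proof -
  note p_pos = one_plus_powr_pos[OF \<alpha> \<rho>]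
  have 3: "3 - j \<in> {1,2}" if "j \<in> {1,2}" for j :: nat using that by auto
  define a where "a = (\<lambda>t (x::'a). \<epsilon> * stable_density \<alpha> (1 + t powr \<rho>) x)"
  define H where "H = (\<lambda>i w t (x::'a). duhamel \<alpha> \<rho> (\<sigma> i) (\<beta> i) w t x)"
  define S where "S = (\<lambda>i t (x::'a). \<epsilon> * profile \<alpha> \<rho> (k i) t x)"
  \<comment> \<open>Zero at negative times, so that the iterates lie between 0 and
    \<open>2 * S\<close> for every real \<open>t\<close>, whereas \<open>a\<close> is compared with
    \<open>S\<close> only for \<open>t \<ge> 0\<close>.\<close>
  define U where "U = rec_nat (\<lambda>i t x. 0) (\<lambda>n V i t (x::'a). if 0 \<le> t then a t x + enn2real (H i (V (3 - i)) t x) else 0)"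
  have U0: "U 0 i t x = 0" and US: "U (Suc n) i t x = (if 0 \<le> t then a t x + enn2real (H i (U n (3 - i)) t x) else 0)" for n i t x
    by (simp_all add: U_def)
  have a0: "0 \<le> a t x" for t x
    unfolding a_def using \<epsilon> stable_density_nonneg[OF \<alpha> p_pos[of t], of x] by simp
  have S0: "0 \<le> S i t x" for i t x
    unfolding S_def by (intro mult_nonneg_nonneg profile_nonneg[OF \<alpha> \<rho>]) (use \<epsilon> in simp)
  have aS: "a t x \<le> S i t x" if "i \<in> {1,2}" "0 \<le> t" for i t x
    unfolding a_def S_def using \<epsilon> k(2)[OF that(1)] that(2)
    by (intro mult_left_mono stable_density_le_profile[OF \<alpha> \<rho>]) auto
  have HS: "H i w t x \<le> ennreal (S i t x)"
    if i: "i \<in> {1,2}" and t: "0 \<le> t" and w: "\<And>s y. 0 < s \<Longrightarrow> 0 \<le> w s y \<and> w s y \<le> 2 * S (3 - i) s y" for i w t x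
  proof (cases "t = 0")
    case False
    with t have t: "0 < t" by simp
    have "H i w t x \<le> ennreal ((2 * \<epsilon>) powr \<beta> i * (stable_density \<alpha> 1 (0::'a) powr (\<beta> i - 1) *
       2 powr (DIM('a) / \<alpha>) / min (\<sigma> i + 1) (DIM('a) * \<rho> / \<alpha> - k i)) * profile \<alpha> \<rho> (k i) t x)"
      unfolding H_def using w \<epsilon> \<beta>[OF i] \<sigma>[OF i] k(2,3)[OF i] t
      by (intro duhamel_profile_le[OF \<alpha> \<rho>, where k = "k (3 - i)"]) (auto simp: S_def mult.assoc)
    also have "\<dots> \<le> ennreal (S i t x)"
      unfolding S_def by (intro ennreal_leI mult_right_mono small i profile_nonneg[OF \<alpha> \<rho>])
    finally show ?thesis .
  qed (simp add: H_def)
  have inv: "(\<lambda>(t, x). U n i t x) \<in> borel_measurable borel \<and> (\<forall>t x. 0 \<le> U n i t x \<and> U n i t x \<le> 2 * S i t x)"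
    if "i \<in> {1,2}" for n i using that
  proof (induction n arbitrary: i)
    case 0
    then show ?case by (simp add: U0 S0)
  next
    case (Suc n)
    note IH = Suc.IH[OF 3[OF Suc.prems]]
    have "(\<lambda>(t, x). H i (U n (3 - i)) t x) \<in> borel_measurable borel"
      unfolding H_def using IH by (intro borel_measurable_duhamel) simp
    then have [measurable]: "case_prod (H i (U n (3 - i))) \<in> borel_measurable (borel \<Otimes>\<^sub>M borel)"
      by (simp add: borel_prod)
    have "(\<lambda>(t, x). U (Suc n) i t x) \<in> borel_measurable (borel \<Otimes>\<^sub>M borel)"
      unfolding US a_def by measurable
    moreover have "0 \<le> U (Suc n) i t x \<and> U (Suc n) i t x \<le> 2 * S i t x" for t x
    proof (cases "0 \<le> t")
      case True
      have "H i (U n (3 - i)) t x \<le> ennreal (S i t x)"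
        using IH by (intro HS Suc.prems True) auto
      then have "enn2real (H i (U n (3 - i)) t x) \<le> S i t x"
        using enn2real_leI[OF S0] by blast
      then show ?thesis using True aS[OF Suc.prems True, of x] a0[of t x] by (simp add: US)
    qed (simp add: US S0)
    ultimately show ?case by (simp add: borel_prod)
  qed
  have HU: "H i (U n (3 - i)) t x \<le> ennreal (S i t x)" if "i \<in> {1,2}" "0 \<le> t" for n i t x
    using inv[OF 3[OF that(1)], of n] by (intro HS that) auto
  \<comment> \<open>\<open>enn2real\<close> sends infinity to 0; finiteness of the Duhamel term
    below the barrier makes the real iteration agree with the equation in [0,\<infinity>].\<close>
  have eqn: "ennreal (U (Suc n) i t x) = ennreal (a t x) + H i (U n (3 - i)) t x" if "i \<in> {1,2}" "0 \<le> t" for n i t x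
  proof -
    have "H i (U n (3 - i)) t x < top" using HU[OF that, of n x] by (simp add: le_less_trans)
    then show ?thesis using that a0 by (simp add: US ennreal_plus)
  qed
  have U_step: "U n i t x \<le> U (Suc n) i t x" if "i \<in> {1,2}" for n i t x
    using that
  proof (induction n arbitrary: i t x)
    case 0
    then show ?case using inv[OF 0, of "Suc 0"] by (simp add: U0)
  next
    case (Suc n)
    show ?case
    proof (cases "0 \<le> t")
      case True
      have "H i (U n (3 - i)) t x \<le> H i (U (Suc n) (3 - i)) t x"
        unfolding H_def using inv[OF 3[OF Suc.prems], of n] Suc.IH[OF 3[OF Suc.prems]] \<beta>[OF Suc.prems]
        by (intro duhamel_mono[OF \<alpha> \<rho>]) auto
      then have "ennreal (U (Suc n) i t x) \<le> ennreal (U (Suc (Suc n)) i t x)"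
        unfolding eqn[OF Suc.prems True] by (rule add_left_mono)
      then show ?thesis using inv[OF Suc.prems, of "Suc (Suc n)"] by (simp add: ennreal_le_iff)
    qed (simp add: US)
  qed
  then have U_mono: "U m i t x \<le> U n i t x" if "i \<in> {1,2}" "m \<le> n" for m n i t x
    using that lift_Suc_mono_le[of "\<lambda>n. U n i t x" m n] by blast
  define u where "u = (\<lambda>i t x. lim (\<lambda>n. U n i t x))"
  have lim: "(\<lambda>n. U n i t x) \<longlonglongrightarrow> u i t x" if i: "i \<in> {1,2}" for i t x
  proof -
    have "incseq (\<lambda>n. U n i t x)" using U_mono[OF i] by (simp add: incseq_def)
    moreover have "\<forall>n. U n i t x \<le> 2 * S i t x" using inv[OF i] by blast
    ultimately have "convergent (\<lambda>n. U n i t x)" using incseq_convergent convergent_def by metis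
    then show ?thesis unfolding u_def by (simp add: convergent_LIMSEQ_iff)
  qed
  have u0: "0 \<le> u i t x" and uS: "u i t x \<le> 2 * S i t x" if "i \<in> {1,2}" for i t x
    using inv[OF that] LIMSEQ_le_const[OF lim[OF that]] LIMSEQ_le_const2[OF lim[OF that]] by blast+
  have um: "(\<lambda>(t, x). u i t x) \<in> borel_measurable borel" if i: "i \<in> {1,2}" for i
  proof (rule borel_measurable_LIMSEQ_real)
    show "(\<lambda>n. case z of (t, x) \<Rightarrow> U n i t x) \<longlonglongrightarrow> (case z of (t, x) \<Rightarrow> u i t x)" for z
      using lim[OF i] by (cases z) auto
  qed (use inv[OF i] in blast)
  have fix_eq: "ennreal (u i t x) = ennreal (a t x) + H i (u (3 - i)) t x" if i: "i \<in> {1,2}" and t: "0 \<le> t" for i t x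
  proof (rule LIMSEQ_unique)
    show "(\<lambda>n. ennreal (U (Suc n) i t x)) \<longlonglongrightarrow> ennreal (u i t x)"
      by (intro tendsto_ennrealI LIMSEQ_Suc lim i)
    have "(\<lambda>n. H i (U n (3 - i)) t x) \<longlonglongrightarrow> H i (u (3 - i)) t x"
      unfolding H_def using inv[OF 3[OF i]] U_mono[OF 3[OF i]] lim[OF 3[OF i]] \<beta>[OF i]
      by (intro duhamel_LIMSEQ[OF \<alpha> \<rho>]) auto
    then show "(\<lambda>n. ennreal (U (Suc n) i t x)) \<longlonglongrightarrow> ennreal (a t x) + H i (u (3 - i)) t x"
      unfolding eqn[OF i t] by (intro tendsto_add tendsto_const)
  qed
  have "mild_solution \<alpha> \<rho> \<beta> \<sigma> \<phi> u"
    unfolding mild_solution_def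
  proof (intro ballI conjI allI impI)
    fix i :: nat assume i: "i \<in> {1,2}"
    show "set_borel_measurable borel ({0..} \<times> UNIV) (\<lambda>(t, x). u i t x)"
      unfolding set_borel_measurable_def
      by (intro borel_measurable_scaleR borel_measurable_indicator um[OF i]) (auto intro!: borel_closed closed_Times)
    show "0 \<le> u i t x" for t x by (rule u0[OF i])
    show "\<exists>M. \<forall>t\<in>{0..T}. \<forall>x. u i t x \<le> M" for T
    proof (intro exI ballI allI)
      fix t x assume "t \<in> {0..T}"
      then have "S i t x \<le> \<epsilon> * stable_density \<alpha> 1 (0::'a)"
        unfolding S_def using \<epsilon> k(1)[OF i] by (intro mult_left_mono profile_le[OF \<alpha> \<rho>]) auto
      then show "u i t x \<le> 2 * (\<epsilon> * stable_density \<alpha> 1 (0::'a))" using uS[OF i, of t x] by linarith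
    qed
    show "u i 0 x = \<phi> i x" for x
    proof -
      have "ennreal (u i 0 x) = ennreal (a 0 x)" using fix_eq[OF i, of 0 x] by (simp add: H_def)
      then have "u i 0 x = a 0 x" by (subst (asm) ennreal_inj[OF u0[OF i] a0])
      then show ?thesis by (simp add: a_def \<phi>[OF i])
    qed
    fix t :: real and x assume t: "0 < t"
    have "(\<integral>\<^sup>+ y. ennreal (stable_density \<alpha> (t powr \<rho>) (y - x) * \<phi> i y) \<partial>lborel)
      = (\<integral>\<^sup>+ y. ennreal \<epsilon> * ennreal (stable_density \<alpha> (t powr \<rho>) (y - x) * stable_density \<alpha> 1 y) \<partial>lborel)"
      using \<epsilon> by (intro nn_integral_cong) (simp add: \<phi>[OF i] ennreal_mult'[symmetric] ac_simps)
    also have "\<dots> = ennreal \<epsilon> * ennreal (stable_density \<alpha> (t powr \<rho> + 1) x)"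
      using t by (subst nn_integral_cmult) (simp_all add: stable_density_convolution[OF \<alpha>])
    also have "\<dots> = ennreal (a t x)"
      using \<epsilon> by (simp add: a_def ennreal_mult'[symmetric] add.commute)
    finally show "ennreal (u i t x) =
        (\<integral>\<^sup>+ y. ennreal (stable_density \<alpha> (t powr \<rho>) (y - x) * \<phi> i y) \<partial>lborel) +
        (\<integral>\<^sup>+ s\<in>{0<..<t}. (\<integral>\<^sup>+ y. ennreal (stable_density \<alpha> (t powr \<rho> - s powr \<rho>) (y - x) *
           s powr \<sigma> i * u (3 - i) s y powr \<beta> i) \<partial>lborel) \<partial>lborel)"
      using fix_eq[OF i, of t x] t by (simp add: H_def duhamel_def)
  qed
  then show ?thesis using uS by (intro exI[of _ u]) (auto simp: S_def mult.assoc)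
qed

end

section \<open>Choice of the exponents and of \<epsilon>\<close>

lemma powr_superlinear_small:
  fixes \<beta> M :: real
  assumes "1 < \<beta>" "0 \<le> M"
  shows "\<exists>e>0. \<forall>\<epsilon>. 0 < \<epsilon> \<and> \<epsilon> \<le> e \<longrightarrow> (2 * \<epsilon>) powr \<beta> * M \<le> \<epsilon>"
proof (intro exI conjI allI impI)
  \<comment> \<open>The threshold is the solution of
    \<open>\<epsilon> powr (\<beta> - 1) * K = 1\<close>; using \<open>M + 1\<close> keeps
    \<open>K\<close> positive when \<open>M = 0\<close>.\<close>
  define K where "K = 2 powr \<beta> * (M + 1)"
  have K: "K > 0" using assms by (simp add: K_def)
  show "0 < K powr (- 1 / (\<beta> - 1))" using K by simp
  fix \<epsilon> assume \<epsilon>: "0 < \<epsilon> \<and> \<epsilon> \<le> K powr (- 1 / (\<beta> - 1))"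
  then have "\<epsilon> powr (\<beta> - 1) \<le> (K powr (- 1 / (\<beta> - 1))) powr (\<beta> - 1)"
    using assms by (intro powr_mono2) auto
  also have "\<dots> = K powr (- 1)" unfolding powr_powr using assms by simp
  also have "\<dots> = 1 / K" using K by (simp add: powr_minus_divide)
  finally have "\<epsilon> powr (\<beta> - 1) * K \<le> 1" using K by (simp add: field_simps)
  have "\<epsilon> powr (\<beta> - 1) * (2 powr \<beta> * M) \<le> \<epsilon> powr (\<beta> - 1) * K"
    unfolding K_def by (intro mult_left_mono) auto
  also have "\<dots> \<le> 1" by fact
  finally have "\<epsilon> * (\<epsilon> powr (\<beta> - 1) * (2 powr \<beta> * M)) \<le> \<epsilon> * 1"
    by (rule mult_left_mono) (use \<epsilon> in simp)
  moreover have "(2 * \<epsilon>) powr \<beta> = 2 powr \<beta> * (\<epsilon> powr (\<beta> - 1) * \<epsilon>)"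
    using \<epsilon> powr_add[of \<epsilon> "\<beta> - 1" 1] by (simp add: powr_mult)
  ultimately show "(2 * \<epsilon>) powr \<beta> * M \<le> \<epsilon>" by (simp add: ac_simps)
qed

theorem theorem4:
  fixes \<alpha> \<rho> :: real and \<beta> \<sigma> :: "nat \<Rightarrow> real"
  assumes "0 < \<alpha>" "\<alpha> \<le> 2" "0 < \<rho>" "\<rho> \<le> 1"
    and "\<And>i. i \<in> {1,2} \<Longrightarrow> \<beta> i > 1"
    and "\<And>i. i \<in> {1,2} \<Longrightarrow> \<sigma> i > -1"
    and "(1 + max (\<sigma> 1 + \<beta> 1 * (1 + \<sigma> 2)) (\<sigma> 2 + \<beta> 2 * (1 + \<sigma> 1))) / (\<beta> 1 * \<beta> 2 - 1)
           < real DIM('a::euclidean_space) * \<rho> / \<alpha>"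
  shows "\<exists>\<epsilon>>0. \<exists>c>0. \<exists>k>0. \<forall>\<phi> :: nat \<Rightarrow> 'a \<Rightarrow> real.
    (\<forall>i\<in>{1,2}. \<forall>x. \<phi> i x = \<epsilon> * stable_density \<alpha> 1 x) \<longrightarrow>
    (\<exists>u. mild_solution \<alpha> \<rho> \<beta> \<sigma> \<phi> u \<and>
      (\<forall>v. mild_solution \<alpha> \<rho> \<beta> \<sigma> \<phi> v \<longrightarrow> (\<forall>i\<in>{1,2}. \<forall>t\<ge>0. \<forall>x. v i t x = u i t x)) \<and>
      (\<forall>i\<in>{1,2}. \<forall>t\<ge>0. \<forall>x.
         u i t x \<le> c * \<epsilon> * (1 + t) powr (- k) * (1 + t powr \<rho>) powr (real DIM('a) / \<alpha>)
                   * stable_density \<alpha> (1 + t powr \<rho>) x))"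
proof -
  note \<alpha> = assms(1,2) and \<rho> = assms(3,4) and \<beta> = assms(5) and \<sigma> = assms(6)
  define D where "D = DIM('a) * \<rho> / \<alpha>"
  define \<Delta> where "\<Delta> = \<beta> 1 * \<beta> 2 - 1"
  have \<Delta>: "\<Delta> > 0" using \<beta>[of 1] \<beta>[of 2] less_1_mult[of "\<beta> 1" "\<beta> 2"] by (simp add: \<Delta>_def)
  \<comment> \<open>The solution of the two balance equations, a linear system with determinant
    \<open>- \<Delta>\<close>. The quotient in the hypothesis is the larger of \<open>k 1\<close>
    and \<open>k 2\<close>.\<close>
  define k where "k = (\<lambda>i::nat. (1 + \<sigma> i + \<beta> i * (1 + \<sigma> (3 - i))) / \<Delta>)"
  have k0: "0 < k i" if "i \<in> {1,2}" for i
  proof -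
    have "3 - i \<in> {1,2}" using that by auto
    then have "0 < \<beta> i * (1 + \<sigma> (3 - i))" using \<sigma>[of "3 - i"] \<beta>[OF that] by (intro mult_pos_pos) linarith+
    then show ?thesis unfolding k_def using \<sigma>[OF that] \<Delta> by (intro divide_pos_pos) linarith+
  qed
  have kD: "k i < D" if "i \<in> {1,2}" for i
  proof -
    have "k i \<le> (1 + max (\<sigma> 1 + \<beta> 1 * (1 + \<sigma> 2)) (\<sigma> 2 + \<beta> 2 * (1 + \<sigma> 1))) / \<Delta>"
      unfolding k_def using that \<Delta> by (intro divide_right_mono) auto
    then show ?thesis using assms(7) by (simp add: D_def \<Delta>_def)
  qed
  have kk: "k (3 - i) * \<beta> i = k i + 1 + \<sigma> i" if "i \<in> {1,2}" for i
  proof -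
    have "(1 + \<sigma> (3 - i) + \<beta> (3 - i) * (1 + \<sigma> i)) * \<beta> i = (1 + \<sigma> i + \<beta> i * (1 + \<sigma> (3 - i))) + \<Delta> * (1 + \<sigma> i)"
      using that by (auto simp: \<Delta>_def algebra_simps)
    moreover have "3 - (3 - i) = i" using that by auto
    ultimately show ?thesis using \<Delta> by (simp add: k_def field_simps)
  qed
  \<comment> \<open>The constant of \<open>duhamel_profile_le\<close> without the power of
    \<open>B\<close>, which will be \<open>2 * \<epsilon>\<close>.\<close>
  define M where "M = (\<lambda>i. stable_density \<alpha> 1 (0::'a) powr (\<beta> i - 1) * 2 powr (DIM('a) / \<alpha>) / min (\<sigma> i + 1) (D - k i))"
  have M: "0 \<le> M i" if "i \<in> {1,2}" for i
    using \<sigma>[OF that] kD[OF that] by (simp add: M_def)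
  obtain e1 e2 where e: "e1 > 0" "e2 > 0"
    "\<And>\<epsilon>. 0 < \<epsilon> \<Longrightarrow> \<epsilon> \<le> e1 \<Longrightarrow> (2 * \<epsilon>) powr \<beta> 1 * M 1 \<le> \<epsilon>"
    "\<And>\<epsilon>. 0 < \<epsilon> \<Longrightarrow> \<epsilon> \<le> e2 \<Longrightarrow> (2 * \<epsilon>) powr \<beta> 2 * M 2 \<le> \<epsilon>"
    using powr_superlinear_small[OF \<beta>[of 1] M[of 1]] powr_superlinear_small[OF \<beta>[of 2] M[of 2]] by auto
  define \<epsilon> where "\<epsilon> = min e1 e2"
  have \<epsilon>: "0 < \<epsilon>" using e by (simp add: \<epsilon>_def)
  have small: "(2 * \<epsilon>) powr \<beta> i * M i \<le> \<epsilon>" if "i \<in> {1,2}" for i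
    using that e(3,4)[OF \<epsilon>] by (auto simp: \<epsilon>_def)
  \<comment> \<open>A smaller exponent gives a larger profile, so the minimum serves both
    components.\<close>
  define k' where "k' = min (k 1) (k 2)"
  have k': "0 < k'" using k0 by (simp add: k'_def)
  show ?thesis
  proof (rule exI[of _ \<epsilon>], intro conjI \<epsilon>, rule exI[of _ 2], intro conjI, simp, rule exI[of _ k'], intro conjI k' allI impI)
    fix \<phi> :: "nat \<Rightarrow> 'a \<Rightarrow> real"
    assume \<phi>: "\<forall>i\<in>{1,2}. \<forall>x. \<phi> i x = \<epsilon> * stable_density \<alpha> 1 x"
    have "\<exists>u. mild_solution \<alpha> \<rho> \<beta> \<sigma> \<phi> u \<and> (\<forall>i\<in>{1,2}. \<forall>t\<ge>0. \<forall>x. u i t x \<le> 2 * \<epsilon> * profile \<alpha> \<rho> (k i) t x)"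
    proof (rule mild_solution_exists[OF \<alpha> \<rho> _ _ _ _ _ \<epsilon>])
      fix i :: nat assume i: "i \<in> {1,2}"
      show "1 < \<beta> i" "-1 < \<sigma> i" "0 < k i" "k (3 - i) * \<beta> i = k i + 1 + \<sigma> i"
        by (rule \<beta> \<sigma> k0 kk, rule i)+
      show "k i < DIM('a) * \<rho> / \<alpha>" using kD[OF i] by (simp add: D_def)
      show "(2 * \<epsilon>) powr \<beta> i * (stable_density \<alpha> 1 (0::'a) powr (\<beta> i - 1) *
          2 powr (DIM('a) / \<alpha>) / min (\<sigma> i + 1) (DIM('a) * \<rho> / \<alpha> - k i)) \<le> \<epsilon>"
        using small[OF i] by (simp only: M_def D_def)
      show "\<phi> i x = \<epsilon> * stable_density \<alpha> 1 x" for x using \<phi> i by blast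
    qed
    then obtain u where u: "mild_solution \<alpha> \<rho> \<beta> \<sigma> \<phi> u"
      and le: "\<And>i t x. i \<in> {1,2} \<Longrightarrow> 0 \<le> t \<Longrightarrow> u i t x \<le> 2 * \<epsilon> * profile \<alpha> \<rho> (k i) t x"
      by blast
    have "profile \<alpha> \<rho> (k i) t x \<le> profile \<alpha> \<rho> k' t x" if "i \<in> {1,2}" "0 \<le> t" for i t and x :: 'a
      unfolding profile_def[OF \<alpha> \<rho>] using that stable_density_nonneg[OF \<alpha> one_plus_powr_pos[OF \<alpha> \<rho>]]
      by (intro mult_right_mono powr_mono) (auto simp: k'_def)
    then have "u i t x \<le> 2 * \<epsilon> * profile \<alpha> \<rho> k' t x" if "i \<in> {1,2}" "0 \<le> t" for i t x
      using le[OF that, of x] \<epsilon> that by (meson mult_left_mono order_trans less_imp_le mult_pos_pos zero_less_numeral)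
    then have "u i t x \<le> 2 * \<epsilon> * (1 + t) powr (- k') * (1 + t powr \<rho>) powr (real DIM('a) / \<alpha>) * stable_density \<alpha> (1 + t powr \<rho>) x"
      if "i \<in> {1,2}" "0 \<le> t" for i t x
      using that by (simp add: profile_def[OF \<alpha> \<rho>] mult.assoc)
    moreover have "v i t x = u i t x" if "mild_solution \<alpha> \<rho> \<beta> \<sigma> \<phi> v" "i \<in> {1,2}" "0 \<le> t" for v i t x
      by (rule mild_solution_unique[OF \<alpha> \<rho> that(1) u \<beta> \<sigma> that(2,3)])
    ultimately show "\<exists>u. mild_solution \<alpha> \<rho> \<beta> \<sigma> \<phi> u \<and>
      (\<forall>v. mild_solution \<alpha> \<rho> \<beta> \<sigma> \<phi> v \<longrightarrow> (\<forall>i\<in>{1,2}. \<forall>t\<ge>0. \<forall>x. v i t x = u i t x)) \<and>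
      (\<forall>i\<in>{1,2}. \<forall>t\<ge>0. \<forall>x.
         u i t x \<le> 2 * \<epsilon> * (1 + t) powr (- k') * (1 + t powr \<rho>) powr (real DIM('a) / \<alpha>)
                   * stable_density \<alpha> (1 + t powr \<rho>) x)"
      using u by blast
  qed
qed

end
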